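(* Let $d\geq 4$ be an integer and let $G$ be a finite simple $d$-regular graph whose adjacency eigenvalues are $\lambda_1(G)\geq \lambda_2(G)\geq \dots\geq \lambda_n(G)$. If $\lambda_2(G)<d-\frac{3}{d+1}$, then $G$ contains at least $2$ edge-disjoint spanning trees.
   Context: The adjacency matrix $A$ of a graph $G$ on $n$ vertices has $(u,v)$-entry $1$ if $uv$ is an edge and $0$ otherwise; its eigenvalues are real and ordered $\lambda_1\geq\lambda_2\geq\dots\geq\lambda_n$. *)

theory Defs
  imports "Jordan_Normal_Form.Char_Poly"
begin

definition simple_graph :: "'a set \<Rightarrow> 'a set set \<Rightarrow> bool" where
  "simple_graph V E \<longleftrightarrow> finite V \<and> V \<noteq> {} \<and> (\<forall>e\<in>E. e \<subseteq> V \<and> card e = 2)"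

definition vertex_degree :: "'a set set \<Rightarrow> 'a \<Rightarrow> nat" where
  "vertex_degree E v = card {e \<in> E. v \<in> e}"

definition regular_graph :: "nat \<Rightarrow> 'a set \<Rightarrow> 'a set set \<Rightarrow> bool" where
  "regular_graph d V E \<longleftrightarrow> (\<forall>v\<in>V. vertex_degree E v = d)"

definition connected_graph :: "'a set \<Rightarrow> 'a set set \<Rightarrow> bool" where
  "connected_graph V E \<longleftrightarrow> V \<noteq> {} \<and> (\<forall>u\<in>V. \<forall>v\<in>V. (u, v) \<in> {(x, y). {x, y} \<in> E}\<^sup>*)"

definition is_cycle :: "'a set set \<Rightarrow> 'a list \<Rightarrow> bool" where
  "is_cycle E c \<longleftrightarrow> 3 \<le> length c \<and> distinct c \<and>
     (\<forall>i < length c. {c ! i, c ! (Suc i mod length c)} \<in> E)"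

definition is_tree :: "'a set \<Rightarrow> 'a set set \<Rightarrow> bool" where
  "is_tree V E \<longleftrightarrow> simple_graph V E \<and> connected_graph V E \<and> (\<nexists>c. is_cycle E c)"

text \<open>A spanning tree of \<open>(V, E)\<close> has vertex set \<open>V\<close>, so it is identified with its edge set.\<close>

definition spanning_tree :: "'a set \<Rightarrow> 'a set set \<Rightarrow> 'a set set \<Rightarrow> bool" where
  "spanning_tree V E T \<longleftrightarrow> T \<subseteq> E \<and> is_tree V T"

definition adjacency_matrix :: "'a list \<Rightarrow> 'a set set \<Rightarrow> real mat" where
  "adjacency_matrix vs E =
     mat (length vs) (length vs) (\<lambda>(i, j). if {vs ! i, vs ! j} \<in> E then 1 else 0)"

text \<open>Matrices are indexed by natural numbers, so the rows are labelled through an enumeration of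
  the vertices. The choice of enumeration does not affect the characteristic polynomial; see
  \<open>char_poly_adjacency_matrix_cong\<close> below.\<close>

definition vertex_enum :: "'a set \<Rightarrow> 'a list" where
  "vertex_enum V = (SOME vs. distinct vs \<and> set vs = V)"

text \<open>The roots of the characteristic polynomial with multiplicity, in non-increasing order. The
  matrix is real symmetric, so taking roots over the reals loses no eigenvalue.\<close>

definition adjacency_eigenvalues :: "'a set \<Rightarrow> 'a set set \<Rightarrow> real list" where
  "adjacency_eigenvalues V E =
     rev (sorted_list_of_multiset (proots (char_poly (adjacency_matrix (vertex_enum V) E))))"

text \<open>The index is 1-based: \<open>graph_eigenvalue V E 1\<close> is the largest eigenvalue.\<close>

definition graph_eigenvalue :: "'a set \<Rightarrow> 'a set set \<Rightarrow> nat \<Rightarrow> real" where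
  "graph_eigenvalue V E k = adjacency_eigenvalues V E ! (k - 1)"

lemma vertex_enum:
  assumes "finite V"
  shows "distinct (vertex_enum V)" "set (vertex_enum V) = V"
proof -
  have "\<exists>vs. distinct vs \<and> set vs = V"
    using finite_distinct_list[OF assms] by blast
  then have "distinct (vertex_enum V) \<and> set (vertex_enum V) = V"
    unfolding vertex_enum_def by (rule someI_ex)
  then show "distinct (vertex_enum V)" "set (vertex_enum V) = V" by auto
qed

lemma det_permute_both:
  fixes A :: "'b :: comm_ring_1 mat"
  assumes A: "A \<in> carrier_mat n n" and p: "p permutes {0..<n}"
  shows "det (mat n n (\<lambda>(i, j). A $$ (p i, p j))) = det A"
proof -
  have pn: "p i < n" if "i < n" for i
    using permutes_in_image[OF p, of i] that by auto
  define B where "B = mat n n (\<lambda>(i, j). A $$ (p i, j))"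
  have B: "B \<in> carrier_mat n n" by (simp add: B_def)
  have BT: "B\<^sup>T \<in> carrier_mat n n" using B by simp
  let ?M = "mat n n (\<lambda>(i, j). A $$ (p i, p j))"
  have M: "?M \<in> carrier_mat n n" by simp
  have "?M = (mat n n (\<lambda>(i, j). B\<^sup>T $$ (p i, j)))\<^sup>T"
    by (rule eq_matI) (auto simp: B_def pn)
  then have "det ?M = det (mat n n (\<lambda>(i, j). B\<^sup>T $$ (p i, j)))"
    using det_transpose[of "mat n n (\<lambda>(i, j). B\<^sup>T $$ (p i, j))" n] by simp
  also have "\<dots> = signof p * det B"
    using det_permute_rows[OF BT p] det_transpose[OF B] by simp
  also have "det B = signof p * det A"
    unfolding B_def by (rule det_permute_rows[OF A p])
  also have "signof p * (signof p * det A) = det A"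
    by (simp add: sign_def)
  finally show ?thesis .
qed

lemma char_poly_adjacency_matrix_cong:
  assumes vs: "distinct vs" and ws: "distinct ws" and eq: "set vs = set ws"
  shows "char_poly (adjacency_matrix vs E) = char_poly (adjacency_matrix ws E)"
proof -
  define n where "n = length ws"
  have len: "length vs = n"
    using distinct_card[OF vs] distinct_card[OF ws] eq n_def by simp
  have "mset vs = mset ws"
    using vs ws eq set_eq_iff_mset_eq_distinct by blast
  then obtain p where p: "p permutes {..<length ws}" and pl: "permute_list p ws = vs"
    by (rule mset_eq_permutation)
  have p': "p permutes {0..<n}" using p by (simp add: n_def lessThan_atLeast0)
  have pn: "p i < n" if "i < n" for i
    using permutes_in_image[OF p', of i] that by auto
  have nth: "vs ! i = ws ! p i" if "i < n" for i
    using permute_list_nth[OF p, of i] pl that n_def by simp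
  have inj: "p i = p j \<longleftrightarrow> i = j" for i j
    using permutes_inj[OF p'] by (auto dest: injD)
  let ?C = "char_poly_matrix (adjacency_matrix ws E)"
  have C: "?C \<in> carrier_mat n n"
    by (simp add: adjacency_matrix_def n_def)
  have "char_poly_matrix (adjacency_matrix vs E) = mat n n (\<lambda>(i, j). ?C $$ (p i, p j))"
    by (rule eq_matI)
      (auto simp: char_poly_matrix_def adjacency_matrix_def len n_def[symmetric] pn nth inj)
  then show ?thesis
    unfolding char_poly_def using det_permute_both[OF C p'] by simp
qed

end

theory Submission
  imports Defs "Jordan_Normal_Form.Schur_Decomposition"
begin

text \<open>
  Suppose there are no two disjoint spanning trees, and take a pair of disjoint forests of maximal
  total size. Let \<open>D\<close> be the set of edges left uncovered by some pair that is reachable from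
  it by exchanging single edges. Each of the two forests, restricted to \<open>D\<close>, has the same components as
  \<open>D\<close>, and every edge outside \<open>D\<close> is covered; counting edges shows that the \<open>t\<close> components of \<open>D\<close>
  are joined by at most \<open>2t - 3\<close> edges (the Nash-Williams--Tutte condition).

  Writing \<open>r(X)\<close> for the number of edges leaving \<open>X\<close> and \<open>e(X,Y)\<close> for the number of edges between
  \<open>X\<close> and \<open>Y\<close>, it follows that some two parts satisfy \<open>r(X) + e(X,Y) \<le> 3\<close> and
  \<open>r(Y) + e(X,Y) \<le> 3\<close>. As \<open>3 < d\<close>, both have at least \<open>d + 1\<close> vertices, so the Rayleigh quotient is
  at least \<open>d - 3/(d+1)\<close> on the plane spanned by their indicator vectors, which bounds the
  second eigenvalue from below.
\<close>

section \<open>Forests and packing two spanning trees\<close>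

definition conn :: "'a set set \<Rightarrow> ('a \<times> 'a) set" where
  "conn F = {(x, y). {x, y} \<in> F}\<^sup>*"

text \<open>Every edge is a bridge. This form of acyclicity suits exchange arguments, which delete
  one edge at a time; since \<open>conn\<close> is reflexive, it also excludes loops.\<close>

definition forest :: "'a set set \<Rightarrow> bool" where
  "forest F \<longleftrightarrow> (\<forall>x y. {x, y} \<in> F \<longrightarrow> (x, y) \<notin> conn (F - {{x, y}}))"

definition conn_class :: "'a set set \<Rightarrow> 'a \<Rightarrow> 'a set" where
  "conn_class F v = {w. (v, w) \<in> conn F}"

lemma conn_refl [simp]: "(x, x) \<in> conn F"
  by (simp add: conn_def)

lemma conn_edge: "{x, y} \<in> F \<Longrightarrow> (x, y) \<in> conn F"
  by (auto simp: conn_def)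

lemma conn_sym: "(x, y) \<in> conn F \<Longrightarrow> (y, x) \<in> conn F"
proof -
  have "sym {(x, y). {x, y} \<in> F}" by (auto simp: sym_def insert_commute)
  then show "(x, y) \<in> conn F \<Longrightarrow> (y, x) \<in> conn F"
    unfolding conn_def by (meson sym_rtrancl symD)
qed

lemma conn_trans: "(x, y) \<in> conn F \<Longrightarrow> (y, z) \<in> conn F \<Longrightarrow> (x, z) \<in> conn F"
  unfolding conn_def by (rule rtrancl_trans)

lemma conn_leI:
  assumes "\<And>x y. {x, y} \<in> F \<Longrightarrow> (x, y) \<in> conn G"
  shows "conn F \<subseteq> conn G"
proof -
  have "{(x, y). {x, y} \<in> F}\<^sup>* \<subseteq> ({(x, y). {x, y} \<in> G}\<^sup>*)\<^sup>*"
    by (rule rtrancl_mono) (use assms in \<open>auto simp: conn_def\<close>)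
  then show ?thesis by (simp add: conn_def)
qed

lemma conn_mono: "F \<subseteq> G \<Longrightarrow> conn F \<subseteq> conn G"
  by (rule conn_leI) (auto intro: conn_edge)

text \<open>A walk through the new edge can be shortened so as to cross it at most once, in one of
  its two directions.\<close>

lemma conn_insert:
  assumes "(x, y) \<in> conn (insert {a, b} F)"
  shows "(x, y) \<in> conn F \<or> (x, a) \<in> conn F \<and> (b, y) \<in> conn F \<or> (x, b) \<in> conn F \<and> (a, y) \<in> conn F"
  using assms unfolding conn_def[of "insert _ _"]
proof (induction rule: rtrancl_induct)
  case base
  then show ?case by simp
next
  case (step y z)
  then have "{y, z} = {a, b} \<or> (y, z) \<in> conn F" by (auto intro: conn_edge)
  then show ?case
    using step.IH unfolding doubleton_eq_iff by (metis conn_refl conn_sym conn_trans)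
qed

lemma conn_class_eq_iff: "conn_class F x = conn_class F y \<longleftrightarrow> (x, y) \<in> conn F"
  unfolding conn_class_def set_eq_iff mem_Collect_eq by (meson conn_refl conn_sym conn_trans)

lemma conn_class_self: "v \<in> conn_class F v"
  by (simp add: conn_class_def)

lemma conn_class_subset:
  assumes "\<And>e. e \<in> F \<Longrightarrow> e \<subseteq> V" "v \<in> V"
  shows "conn_class F v \<subseteq> V"
proof
  fix w assume "w \<in> conn_class F v"
  then have "(v, w) \<in> {(x, y). {x, y} \<in> F}\<^sup>*" by (simp add: conn_class_def conn_def)
  then show "w \<in> V" by induction (use assms in auto)
qed

lemma forest_subset: "forest F \<Longrightarrow> G \<subseteq> F \<Longrightarrow> forest G"
  unfolding forest_def by (meson Diff_mono conn_mono order_refl subsetD)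

lemma forest_insert:
  assumes "forest F" "(a, b) \<notin> conn F"
  shows "forest (insert {a, b} F)"
  unfolding forest_def
proof (intro allI impI notI)
  fix x y assume xy: "{x, y} \<in> insert {a, b} F" and c: "(x, y) \<in> conn (insert {a, b} F - {{x, y}})"
  have abF: "{a, b} \<notin> F" using assms(2) conn_edge by metis
  show False
  proof (cases "{x, y} = {a, b}")
    case True
    then have "(x, y) \<in> conn F" using c abF by simp
    then show False using True assms(2) by (auto simp: doubleton_eq_iff dest: conn_sym)
  next
    case False
    let ?F = "F - {{x, y}}"
    have "insert {a, b} F - {{x, y}} = insert {a, b} ?F" using False by auto
    then have "(x, y) \<in> conn ?F \<or> (x, a) \<in> conn ?F \<and> (b, y) \<in> conn ?F \<or> (x, b) \<in> conn ?F \<and> (a, y) \<in> conn ?F"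
      using c conn_insert by metis
    moreover have xyF: "{x, y} \<in> F" using xy False by simp
    then have "(x, y) \<notin> conn ?F" using assms(1) by (simp add: forest_def)
    moreover have "conn ?F \<subseteq> conn F" by (rule conn_mono) auto
    \<comment> \<open>The detour from \<open>x\<close> to \<open>y\<close> crosses the new edge; its
      two remaining pieces together with the old edge \<open>{x, y}\<close> join \<open>a\<close> to
      \<open>b\<close> inside \<open>F\<close>.\<close>
    ultimately have "(a, b) \<in> conn F"
      using conn_edge[OF xyF] by (meson conn_sym conn_trans subsetD)
    then show False using assms(2) by simp
  qed
qed

text \<open>Starting from singletons, each new edge of a forest joins two different classes and so
  lowers their number by exactly one.\<close>

lemma card_conn_classes_forest:
  assumes "finite V" "finite F" "forest F" "\<And>e. e \<in> F \<Longrightarrow> e \<subseteq> V \<and> card e = 2"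
  shows "card (conn_class F ` V) + card F = card V"
  using assms(2-4)
proof (induction F rule: finite_induct)
  case empty
  have "conn_class {} v = {v}" for v :: 'a by (auto simp: conn_class_def conn_def)
  then show ?case by (simp add: card_image)
next
  case (insert e F)
  obtain a b where e: "e = {a, b}" "a \<noteq> b" using insert.prems(2)[of e] by (auto simp: card_2_iff)
  have ab: "a \<in> V" "b \<in> V" using insert.prems(2)[of e] e by auto
  have nab: "(a, b) \<notin> conn F" using insert.prems(1) insert.hyps(2) e by (auto simp: forest_def)
  have IH: "card (conn_class F ` V) + card F = card V"
    using insert.IH insert.prems forest_subset[OF insert.prems(1)] by auto
  let ?A = "conn_class F a" and ?B = "conn_class F b" and ?G = "insert e F"
  have mono: "conn F \<subseteq> conn ?G" by (rule conn_mono) auto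
  have abG: "(a, b) \<in> conn ?G" using e by (auto intro: conn_edge)
  have cls: "conn_class ?G v = (if v \<in> ?A \<union> ?B then ?A \<union> ?B else conn_class F v)" for v
  proof -
    have "(v, w) \<in> conn ?G \<longleftrightarrow> (if v \<in> ?A \<union> ?B then w \<in> ?A \<union> ?B else (v, w) \<in> conn F)" for w
    proof
      assume "(v, w) \<in> conn ?G"
      then have "(v, w) \<in> conn F \<or> (v, a) \<in> conn F \<and> (b, w) \<in> conn F \<or> (v, b) \<in> conn F \<and> (a, w) \<in> conn F"
        using conn_insert e by metis
      then show "if v \<in> ?A \<union> ?B then w \<in> ?A \<union> ?B else (v, w) \<in> conn F"
        unfolding conn_class_def Un_iff mem_Collect_eq by (metis conn_sym conn_trans)
    next
      assume vw: "if v \<in> ?A \<union> ?B then w \<in> ?A \<union> ?B else (v, w) \<in> conn F"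
      show "(v, w) \<in> conn ?G"
      proof (cases "v \<in> ?A \<union> ?B")
        case True
        then have "w \<in> ?A \<union> ?B" using vw by simp
        moreover have "(a, u) \<in> conn ?G" if "u \<in> ?A \<union> ?B" for u
          using that mono conn_trans[OF abG, of u] by (auto simp: conn_class_def)
        ultimately show ?thesis using True conn_sym conn_trans by metis
      next
        case False
        then have "(v, w) \<in> conn F" using vw by simp
        then show ?thesis using mono by auto
      qed
    qed
    then show ?thesis unfolding conn_class_def[of ?G] by (auto simp: conn_class_def)
  qed
  have img: "conn_class ?G ` V = insert (?A \<union> ?B) (conn_class F ` V - {?A, ?B})"
  proof (intro equalityI subsetI)
    fix X assume "X \<in> conn_class ?G ` V"
    then obtain v where v: "v \<in> V" "X = conn_class ?G v" by auto
    show "X \<in> insert (?A \<union> ?B) (conn_class F ` V - {?A, ?B})"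
    proof (cases "v \<in> ?A \<union> ?B")
      case False
      then have "conn_class F v \<noteq> ?A" "conn_class F v \<noteq> ?B" using conn_class_self by fast+
      then show ?thesis using v cls False by auto
    qed (use v cls in auto)
  next
    fix X assume "X \<in> insert (?A \<union> ?B) (conn_class F ` V - {?A, ?B})"
    then consider "X = ?A \<union> ?B" | v where "v \<in> V" "X = conn_class F v" "X \<noteq> ?A" "X \<noteq> ?B" by auto
    then show "X \<in> conn_class ?G ` V"
    proof cases
      case 1
      then have "X = conn_class ?G a" using cls conn_class_self[of a F] by auto
      then show ?thesis using ab by auto
    next
      case 2
      then have "v \<notin> ?A \<union> ?B" by (metis Un_iff conn_class_def conn_class_eq_iff mem_Collect_eq)
      then have "X = conn_class ?G v" using cls 2 by auto
      then show ?thesis using 2 by auto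
    qed
  qed
  have neq: "?A \<noteq> ?B" using nab conn_class_eq_iff by metis
  \<comment> \<open>An old class equal to the union would contain \<open>a\<close>, hence be
    \<open>?A\<close>, which has been removed. So the merged class is counted as a new one.\<close>
  have notin: "?A \<union> ?B \<notin> conn_class F ` V - {?A, ?B}"
  proof
    assume "?A \<union> ?B \<in> conn_class F ` V - {?A, ?B}"
    then obtain v where v: "conn_class F v = ?A \<union> ?B" "conn_class F v \<noteq> ?A" by auto
    then have "a \<in> conn_class F v" using conn_class_self[of a F] by blast
    then have "(v, a) \<in> conn F" by (simp add: conn_class_def)
    then show False using v conn_class_eq_iff by metis
  qed
  have "card (conn_class ?G ` V) = Suc (card (conn_class F ` V - {?A, ?B}))"
    unfolding img using notin assms(1) by simp
  also have "card (conn_class F ` V - {?A, ?B}) = card (conn_class F ` V) - 2"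
    using neq ab assms(1) by (subst card_Diff_subset) auto
  finally have "card (conn_class ?G ` V) = Suc (card (conn_class F ` V) - 2)" .
  \<comment> \<open>The two distinct classes make the truncated subtraction of 2 a genuine
    one.\<close>
  moreover have "card {?A, ?B} \<le> card (conn_class F ` V)"
    using ab assms(1) by (intro card_mono) auto
  then have "2 \<le> card (conn_class F ` V)" using neq by simp
  ultimately show ?case using IH insert.hyps by simp
qed

text \<open>The rest of a cycle bypasses its closing edge, which is then no bridge. With at least
  three distinct vertices, none of the other edges coincides with the closing one.\<close>

lemma forest_no_cycle:
  assumes "forest F"
  shows "\<not> is_cycle F c"
proof
  assume "is_cycle F c"
  then have len: "3 \<le> length c" and dist: "distinct c"
    and ed: "\<And>i. i < length c \<Longrightarrow> {c ! i, c ! (Suc i mod length c)} \<in> F"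
    by (auto simp: is_cycle_def)
  define m where "m = length c - 1"
  have m: "Suc m = length c" "2 \<le> m" using len by (auto simp: m_def)
  let ?f = "{c ! m, c ! 0}"
  have "?f \<in> F" using ed[of m] m by simp
  have "(c ! 0, c ! k) \<in> conn (F - {?f})" if "k \<le> m" for k
    using that
  proof (induction k)
    case (Suc k)
    have "{c ! k, c ! Suc k} \<in> F" using ed[of k] m Suc.prems by simp
    moreover have "{c ! k, c ! Suc k} \<noteq> ?f"
      using Suc.prems m nth_eq_iff_index_eq[OF dist, of k 0] nth_eq_iff_index_eq[OF dist, of k m]
        nth_eq_iff_index_eq[OF dist, of "Suc k" 0]
        nth_eq_iff_index_eq[OF dist, of "Suc k" m] len unfolding doubleton_eq_iff by linarith
    ultimately have "(c ! k, c ! Suc k) \<in> conn (F - {?f})" by (auto intro: conn_edge)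
    then show ?case using Suc conn_trans by (metis Suc_leD)
  qed simp
  then have "(c ! m, c ! 0) \<in> conn (F - {?f})" by (auto intro: conn_sym)
  then show False using assms \<open>?f \<in> F\<close> by (auto simp: forest_def)
qed

text \<open>In a forest the edges whose removal separates \<open>x\<close> from \<open>y\<close> form the path from
  \<open>x\<close> to \<open>y\<close>.\<close>

lemma conn_separating_edges:
  assumes "forest F" "finite F" "(x, y) \<in> conn F" "\<And>e. e \<in> F \<Longrightarrow> card e = 2"
  shows "(x, y) \<in> conn {f \<in> F. (x, y) \<notin> conn (F - {f})}"
proof -
  \<comment> \<open>A connecting edge set of least size plays the role of the path.\<close>
  define Q where "Q = (ARG_MIN card Q. Q \<subseteq> F \<and> (x, y) \<in> conn Q)"
  have Q: "Q \<subseteq> F \<and> (x, y) \<in> conn Q"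
    and least: "\<And>R. R \<subseteq> F \<and> (x, y) \<in> conn R \<Longrightarrow> card Q \<le> card R"
    using arg_min_nat_lemma[of "\<lambda>Q. Q \<subseteq> F \<and> (x, y) \<in> conn Q" F card] assms(3)
    unfolding Q_def by auto
  \<comment> \<open>Minimality makes \<open>f\<close> separating only within \<open>Q\<close>. If
    \<open>F\<close> had another route from \<open>x\<close> to \<open>y\<close> avoiding
    \<open>f\<close>, it would close up with the two pieces of \<open>Q - {f}\<close> to join the
    ends of \<open>f\<close> without \<open>f\<close>, which a forest forbids.\<close>
  have "(x, y) \<notin> conn (F - {f})" if f: "f \<in> Q" for f
  proof
    assume c: "(x, y) \<in> conn (F - {f})"
    obtain a b where ab: "f = {a, b}" using assms(4)[of f] f Q by (auto simp: card_2_iff)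
    have "card (Q - {f}) < card Q"
      using f Q assms(2) by (intro psubset_card_mono) (auto intro: finite_subset)
    then have "(x, y) \<notin> conn (Q - {f})" using least[of "Q - {f}"] Q by auto
    moreover have "insert {a, b} (Q - {f}) = Q" using f ab by auto
    then have "(x, y) \<in> conn (insert {a, b} (Q - {f}))" using Q by simp
    ultimately have "(x, a) \<in> conn (Q - {f}) \<and> (b, y) \<in> conn (Q - {f}) \<or>
        (x, b) \<in> conn (Q - {f}) \<and> (a, y) \<in> conn (Q - {f})"
      using conn_insert by metis
    moreover have "conn (Q - {f}) \<subseteq> conn (F - {f})" using Q by (intro conn_mono) auto
    ultimately have "(a, b) \<in> conn (F - {f})"
      using c by (meson conn_sym conn_trans subsetD)
    then show False using assms(1) f Q ab by (auto simp: forest_def)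
  qed
  then have "Q \<subseteq> {f \<in> F. (x, y) \<notin> conn (F - {f})}" using Q by auto
  then show ?thesis using Q conn_mono by blast
qed

section \<open>Exchanges in a maximal pair of disjoint forests\<close>

definition forest_pair :: "'a set set \<Rightarrow> 'a set set \<times> 'a set set \<Rightarrow> bool" where
  "forest_pair E FG \<longleftrightarrow> fst FG \<subseteq> E \<and> snd FG \<subseteq> E \<and> fst FG \<inter> snd FG = {} \<and>
     forest (fst FG) \<and> forest (snd FG)"

abbreviation pair_size :: "'a set set \<times> 'a set set \<Rightarrow> nat" where
  "pair_size FG \<equiv> card (fst FG) + card (snd FG)"

text \<open>An uncovered edge enters one forest in place of \<open>f\<close>. Requiring its ends to
  be apart once \<open>f\<close> is gone is what keeps the result a forest, and the total size stays
  the same.\<close>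

inductive exchange_reachable ::
    "'a set set \<Rightarrow> 'a set set \<times> 'a set set \<Rightarrow> 'a set set \<times> 'a set set \<Rightarrow> bool"
  for E S where
  start: "exchange_reachable E S S"
| swap1: "exchange_reachable E S (F, G) \<Longrightarrow> {x, y} \<in> E - (F \<union> G) \<Longrightarrow> f \<in> F \<Longrightarrow>
    (x, y) \<notin> conn (F - {f}) \<Longrightarrow> exchange_reachable E S (insert {x, y} (F - {f}), G)"
| swap2: "exchange_reachable E S (F, G) \<Longrightarrow> {x, y} \<in> E - (F \<union> G) \<Longrightarrow> f \<in> G \<Longrightarrow>
    (x, y) \<notin> conn (G - {f}) \<Longrightarrow> exchange_reachable E S (F, insert {x, y} (G - {f}))"

locale max_forest_pair =
  fixes E :: "'a set set" and S :: "'a set set \<times> 'a set set"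
  assumes finE: "finite E" and card2: "\<And>e. e \<in> E \<Longrightarrow> card e = 2"
    and pair: "forest_pair E S"
    and max: "\<And>FG. forest_pair E FG \<Longrightarrow> pair_size FG \<le> pair_size S"
begin

text \<open>This is the set \<open>D\<close> of the overview; its components become the parts of the
  sparse partition.\<close>

definition loose :: "'a set set" where
  "loose = {e. \<exists>F G. exchange_reachable E S (F, G) \<and> e \<in> E - (F \<union> G)}"

lemma reachable_forest_pair:
  "exchange_reachable E S FG \<Longrightarrow> forest_pair E FG \<and> pair_size FG = pair_size S"
proof (induction rule: exchange_reachable.induct)
  case start
  then show ?case using pair by simp
next
  case (swap1 F G x y f)
  then have "finite F" using finE finite_subset[of F E] by (auto simp: forest_pair_def)
  then have "card (insert {x, y} (F - {f})) = card F"
    using card_insert_disjoint[of "F - {f}" "{x, y}"] card_Suc_Diff1[of F f] swap1(2,3)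
    by (metis Diff_iff UnCI finite_Diff)
  moreover have "forest (F - {f})"
    using swap1 forest_subset[of F "F - {f}"] by (auto simp: forest_pair_def)
  ultimately show ?case
    using swap1 forest_insert[of "F - {f}" x y] by (auto simp: forest_pair_def)
next
  case (swap2 F G x y f)
  then have "finite G" using finE finite_subset[of G E] by (auto simp: forest_pair_def)
  then have "card (insert {x, y} (G - {f})) = card G"
    using card_insert_disjoint[of "G - {f}" "{x, y}"] card_Suc_Diff1[of G f] swap2(2,3)
    by (metis Diff_iff UnCI finite_Diff)
  moreover have "forest (G - {f})"
    using swap2 forest_subset[of G "G - {f}"] by (auto simp: forest_pair_def)
  ultimately show ?case
    using swap2 forest_insert[of "G - {f}" x y] by (auto simp: forest_pair_def)
qed

text \<open>Reachable pairs still have maximal size, so an uncovered edge can be added to neither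
  forest.\<close>

lemma uncovered_conn:
  assumes r: "exchange_reachable E S (F, G)" and e: "{x, y} \<in> E - (F \<union> G)"
  shows "(x, y) \<in> conn F" "(x, y) \<in> conn G"
proof -
  have p: "forest_pair E (F, G)" "card F + card G = pair_size S"
    using reachable_forest_pair[OF r] by auto
  then have fin: "finite F" "finite G" using finE by (auto simp: forest_pair_def intro: finite_subset)
  show "(x, y) \<in> conn F"
  proof (rule ccontr)
    assume "(x, y) \<notin> conn F"
    then have "forest_pair E (insert {x, y} F, G)"
      using p e by (auto simp: forest_pair_def intro: forest_insert)
    then show False using max[of "(insert {x, y} F, G)"] p e fin by auto
  qed
  show "(x, y) \<in> conn G"
  proof (rule ccontr)
    assume "(x, y) \<notin> conn G"
    then have "forest_pair E (F, insert {x, y} G)"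
      using p e by (auto simp: forest_pair_def intro: forest_insert)
    then show False using max[of "(F, insert {x, y} G)"] p e fin by auto
  qed
qed

text \<open>Any edge on the path of the forest from \<open>x\<close> to \<open>y\<close> can be
  exchanged for \<open>{x, y}\<close>. It is then uncovered in a reachable pair, so the whole path
  consists of loose edges.\<close>

lemma uncovered_conn_loose:
  assumes r: "exchange_reachable E S (F, G)" and e: "{x, y} \<in> E - (F \<union> G)"
  shows "(x, y) \<in> conn (F \<inter> loose)" "(x, y) \<in> conn (G \<inter> loose)"
proof -
  have p: "forest_pair E (F, G)" using reachable_forest_pair[OF r] by auto
  then have fin: "finite F" "finite G" using finE by (auto simp: forest_pair_def intro: finite_subset)
  have disj: "F \<inter> G = {}" "F \<subseteq> E" "G \<subseteq> E" using p by (auto simp: forest_pair_def)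
  have "f \<in> loose" if f: "f \<in> F" "(x, y) \<notin> conn (F - {f})" for f
  proof -
    have "f \<in> E - (insert {x, y} (F - {f}) \<union> G)" using f disj e by auto
    then show ?thesis unfolding loose_def using exchange_reachable.swap1[OF r e f] by blast
  qed
  then have "{f \<in> F. (x, y) \<notin> conn (F - {f})} \<subseteq> F \<inter> loose" by auto
  moreover have "(x, y) \<in> conn {f \<in> F. (x, y) \<notin> conn (F - {f})}"
    using p fin disj uncovered_conn[OF r e] card2
    by (intro conn_separating_edges) (auto simp: forest_pair_def)
  ultimately show "(x, y) \<in> conn (F \<inter> loose)" using conn_mono by blast
  have "f \<in> loose" if f: "f \<in> G" "(x, y) \<notin> conn (G - {f})" for f
  proof -
    have "f \<in> E - (F \<union> insert {x, y} (G - {f}))" using f disj e by auto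
    then show ?thesis unfolding loose_def using exchange_reachable.swap2[OF r e f] by blast
  qed
  then have "{f \<in> G. (x, y) \<notin> conn (G - {f})} \<subseteq> G \<inter> loose" by auto
  moreover have "(x, y) \<in> conn {f \<in> G. (x, y) \<notin> conn (G - {f})}"
    using p fin disj uncovered_conn[OF r e] card2
    by (intro conn_separating_edges) (auto simp: forest_pair_def)
  ultimately show "(x, y) \<in> conn (G \<inter> loose)" using conn_mono by blast
qed

text \<open>The edge that enters in an exchange has its ends already joined by loose edges of that
  forest, so connectivity through loose edges never grows along exchanges. This carries information
  from any reachable pair back to \<open>S\<close>.\<close>

lemma reachable_conn_loose:
  "exchange_reachable E S FG \<Longrightarrow>
    conn (fst FG \<inter> loose) \<subseteq> conn (fst S \<inter> loose) \<and> conn (snd FG \<inter> loose) \<subseteq> conn (snd S \<inter> loose)"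
proof (induction rule: exchange_reachable.induct)
  case (swap1 F G x y f)
  have "conn (insert {x, y} (F - {f}) \<inter> loose) \<subseteq> conn (F \<inter> loose)"
  proof (rule conn_leI)
    fix u v assume "{u, v} \<in> insert {x, y} (F - {f}) \<inter> loose"
    then have "{u, v} = {x, y} \<or> {u, v} \<in> F \<inter> loose" by auto
    then show "(u, v) \<in> conn (F \<inter> loose)"
      using uncovered_conn_loose(1)[OF swap1(1,2)]
      by (auto simp: doubleton_eq_iff intro: conn_edge conn_sym)
  qed
  then show ?case using swap1 by auto
next
  case (swap2 F G x y f)
  have "conn (insert {x, y} (G - {f}) \<inter> loose) \<subseteq> conn (G \<inter> loose)"
  proof (rule conn_leI)
    fix u v assume "{u, v} \<in> insert {x, y} (G - {f}) \<inter> loose"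
    then have "{u, v} = {x, y} \<or> {u, v} \<in> G \<inter> loose" by auto
    then show "(u, v) \<in> conn (G \<inter> loose)"
      using uncovered_conn_loose(2)[OF swap2(1,2)]
      by (auto simp: doubleton_eq_iff intro: conn_edge conn_sym)
  qed
  then show ?case using swap2 by auto
qed auto

text \<open>A loose edge is uncovered in some reachable pair, whose two forests join its ends by
  loose edges; by the previous monotonicity so do the forests of \<open>S\<close>. Hence both have
  as many loose edges as a spanning forest of \<open>loose\<close>.\<close>

lemma conn_loose:
  "conn (fst S \<inter> loose) = conn loose" "conn (snd S \<inter> loose) = conn loose"
proof -
  have "(x, y) \<in> conn (fst S \<inter> loose) \<and> (x, y) \<in> conn (snd S \<inter> loose)" if xy: "{x, y} \<in> loose" for x y
  proof -
    obtain F G where r: "exchange_reachable E S (F, G)" and e: "{x, y} \<in> E - (F \<union> G)"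
      using xy unfolding loose_def by auto
    show ?thesis using uncovered_conn_loose[OF r e] reachable_conn_loose[OF r] by auto
  qed
  then have "conn loose \<subseteq> conn (fst S \<inter> loose)" "conn loose \<subseteq> conn (snd S \<inter> loose)"
    by (intro conn_leI; blast)+
  moreover have "conn (fst S \<inter> loose) \<subseteq> conn loose" "conn (snd S \<inter> loose) \<subseteq> conn loose"
    by (intro conn_mono; blast)+
  ultimately show "conn (fst S \<inter> loose) = conn loose" "conn (snd S \<inter> loose) = conn loose" by auto
qed

lemma uncovered_loose: "E - (fst S \<union> snd S) \<subseteq> loose"
  using exchange_reachable.start[of E S] unfolding loose_def by (cases S) auto

lemma loose_subset: "loose \<subseteq> E"
  unfolding loose_def by auto

end

section \<open>Two spanning trees or a sparse partition\<close>

lemma spanning_treeI: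
  assumes "simple_graph V E" "F \<subseteq> E" "forest F" "card V \<le> card F + 1"
  shows "spanning_tree V E F"
proof -
  have V: "finite V" "V \<noteq> {}" and ed: "\<And>e. e \<in> F \<Longrightarrow> e \<subseteq> V \<and> card e = 2"
    using assms(1,2) by (auto simp: simple_graph_def)
  have "F \<subseteq> Pow V" using ed by blast
  then have finF: "finite F" using V by (simp add: finite_subset)
  have "card (conn_class F ` V) \<le> 1"
    using card_conn_classes_forest[OF V(1) finF assms(3) ed] assms(4) by auto
  then have "conn_class F u = conn_class F v" if "u \<in> V" "v \<in> V" for u v
    using that V by (metis One_nat_def card_le_Suc0_iff_eq finite_imageI image_eqI)
  then have "connected_graph V F"
    using V unfolding connected_graph_def conn_class_eq_iff conn_def by simp
  then show ?thesis
    using assms V ed forest_no_cycle[OF assms(3)]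
    unfolding spanning_tree_def is_tree_def simple_graph_def by auto
qed

text \<open>The partition is encoded by its components: no edge of \<open>D\<close> runs between two
  classes, so \<open>card (E - D)\<close> bounds the number of edges joining different
  parts.\<close>

theorem two_disjoint_spanning_trees_or_sparse_partition:
  assumes G: "simple_graph V E"
  shows "(\<exists>T1 T2. spanning_tree V E T1 \<and> spanning_tree V E T2 \<and> T1 \<inter> T2 = {}) \<or>
    (\<exists>D \<subseteq> E. card (E - D) + 3 \<le> 2 * card (conn_class D ` V))"
proof -
  have V: "finite V" "V \<noteq> {}" and ed: "\<And>e. e \<in> E \<Longrightarrow> e \<subseteq> V \<and> card e = 2"
    using G by (auto simp: simple_graph_def)
  have "E \<subseteq> Pow V" using ed by blast
  then have finE: "finite E" using V by (simp add: finite_subset)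
  have "forest_pair E ({}, {})" by (auto simp: forest_pair_def forest_def)
  moreover have "\<forall>FG. forest_pair E FG \<longrightarrow> pair_size FG < 2 * card E + 1"
  proof (intro allI impI)
    fix FG assume "forest_pair E FG"
    then have "card (fst FG) \<le> card E" "card (snd FG) \<le> card E"
      using finE by (auto simp: forest_pair_def intro: card_mono)
    then show "pair_size FG < 2 * card E + 1" by simp
  qed
  ultimately obtain S where S: "forest_pair E S"
    and mx: "\<And>FG. forest_pair E FG \<Longrightarrow> pair_size FG \<le> pair_size S"
    using ex_has_greatest_nat[of "forest_pair E" "({}, {})" pair_size "2 * card E + 1"]
    by (metis (no_types, lifting) less_imp_le_nat)
  interpret max_forest_pair E S
    by unfold_locales (use finE ed S mx in auto)
  obtain F1 F2 where SF: "S = (F1, F2)" by (cases S)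
  have F: "F1 \<subseteq> E" "F2 \<subseteq> E" "F1 \<inter> F2 = {}" "forest F1" "forest F2"
    using S SF by (auto simp: forest_pair_def)
  have finF: "finite F1" "finite F2" using F finE by (auto intro: finite_subset)
  let ?t = "card (conn_class loose ` V)"
  have cls: "conn_class (F1 \<inter> loose) = conn_class loose" "conn_class (F2 \<inter> loose) = conn_class loose"
    using conn_loose SF by (auto simp: conn_class_def fun_eq_iff)
  have c1: "?t + card (F1 \<inter> loose) = card V"
    using card_conn_classes_forest[of V "F1 \<inter> loose"] V finF F ed
    by (metis (no_types, lifting) Int_lower1 cls(1) finite_Int forest_subset subset_eq)
  have c2: "?t + card (F2 \<inter> loose) = card V"
    using card_conn_classes_forest[of V "F2 \<inter> loose"] V finF F ed
    by (metis (no_types, lifting) Int_lower1 cls(2) finite_Int forest_subset subset_eq)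
  have n1: "card F1 + 1 \<le> card V" and n2: "card F2 + 1 \<le> card V"
  proof -
    have "card (conn_class F1 ` V) > 0" "card (conn_class F2 ` V) > 0" using V by (auto simp: card_gt_0_iff)
    then show "card F1 + 1 \<le> card V" "card F2 + 1 \<le> card V"
      using card_conn_classes_forest[OF V(1) finF(1) F(4)] card_conn_classes_forest[OF V(1) finF(2) F(5)]
        F ed by fastforce+
  qed
  show ?thesis
  proof (cases "card V \<le> card F1 + 1 \<and> card V \<le> card F2 + 1")
    case True
    then show ?thesis using spanning_treeI[OF G] F by blast
  next
    case False
    \<comment> \<open>Uncovered edges are loose, so every edge outside \<open>loose\<close> lies in
      one of the two forests.\<close>
    have "E - loose \<subseteq> (F1 - loose) \<union> (F2 - loose)" using uncovered_loose SF by auto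
    then have "card (E - loose) \<le> card ((F1 - loose) \<union> (F2 - loose))"
      using finF by (intro card_mono) auto
    also have "\<dots> \<le> card (F1 - loose) + card (F2 - loose)" by (rule card_Un_le)
    also have "card (F1 - loose) = card F1 - card (F1 \<inter> loose)"
      using finF by (simp add: card_Diff_subset_Int)
    also have "card (F2 - loose) = card F2 - card (F2 \<inter> loose)"
      using finF by (simp add: card_Diff_subset_Int)
    finally have "card (E - loose) \<le> card F1 - card (F1 \<inter> loose) + (card F2 - card (F2 \<inter> loose))" .
    moreover have "card (F1 \<inter> loose) \<le> card F1" "card (F2 \<inter> loose) \<le> card F2"
      using finF by (auto intro: card_mono)
    \<comment> \<open>One forest falls short of a spanning tree, so together they have at most
      \<open>2 * card V - 3\<close> edges; of these \<open>2 * (card V - ?t)\<close> are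
      loose.\<close>
    ultimately have "card (E - loose) + 3 \<le> 2 * ?t"
      using c1 c2 n1 n2 False by linarith
    then show ?thesis using loose_subset by blast
  qed
qed

section \<open>Real symmetric matrices\<close>

text \<open>Complete \<open>v\<close> to a basis, orthogonalise it by Gram-Schmidt, which keeps the
  first vector, and normalise. The result is the change of basis that splits off one
  eigenvector.\<close>

lemma orthogonal_matrix_with_first_column:
  fixes v :: "real vec"
  assumes v: "v \<in> carrier_vec n" and v1: "v \<bullet> v = 1"
  shows "\<exists>W \<in> carrier_mat n n. W\<^sup>T * W = 1\<^sub>m n \<and> col W 0 = v"
proof -
  have v0: "v \<noteq> 0\<^sub>v n" using v1 by auto
  have n: "n \<noteq> 0"
  proof
    assume "n = 0"
    then show False using v v1 by (simp add: scalar_prod_def)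
  qed
  interpret cof_vec_space n "TYPE(real)" .
  define b where "b = basis_completion v"
  define ws where "ws = gram_schmidt n b"
  from basis_completion[OF v v0, folded b_def]
  have dist_b: "distinct b" and indep: "\<not> lin_dep (set b)" and b: "set b \<subseteq> carrier_vec n"
    and hdb: "hd b = v" and len_b: "length b = n" by auto
  obtain vs where bv: "b = v # vs" using hdb len_b n by (cases b) auto
  have ws: "set ws \<subseteq> carrier_vec n" "corthogonal ws" "length ws = n"
    using gram_schmidt_result[OF b dist_b indep refl, folded ws_def] by (auto simp: len_b)
  have "hd ws = v" using gram_schmidt_hd[OF v, of vs, folded bv] unfolding ws_def .
  then have ws0: "ws ! 0 = v" using ws(3) n by (metis hd_conv_nth length_0_conv)
  have wsi: "ws ! i \<in> carrier_vec n" if "i < n" for i using ws that by auto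
  \<comment> \<open>For \<open>i = j\<close> the equivalence says that no vector has length zero, so
    division by \<open>nrm i\<close> is legitimate.\<close>
  have orth: "ws ! i \<bullet> ws ! j = 0 \<longleftrightarrow> i \<noteq> j" if "i < n" "j < n" for i j
    using corthogonalD[OF ws(2)] ws(3) that by simp
  define nrm where "nrm i = sqrt (ws ! i \<bullet> ws ! i)" for i
  have nn: "ws ! i \<bullet> ws ! i \<ge> 0" for i by (simp add: scalar_prod_def sum_nonneg)
  define us where "us = map (\<lambda>i. (1 / nrm i) \<cdot>\<^sub>v ws ! i) [0..<n]"
  have usi: "us ! i = (1 / nrm i) \<cdot>\<^sub>v ws ! i" if "i < n" for i using that by (simp add: us_def)
  define W where "W = mat_of_cols n us"
  have W: "W \<in> carrier_mat n n" using mat_of_cols_carrier(1)[of n us] by (simp add: W_def us_def)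
  have colW: "col W i = us ! i" if "i < n" for i
    using that wsi[OF that] unfolding W_def by (intro col_mat_of_cols) (auto simp: us_def)
  have "W\<^sup>T * W = 1\<^sub>m n"
  proof (rule eq_matI)
    fix i j assume ij: "i < dim_row (1\<^sub>m n)" "j < dim_col (1\<^sub>m n)"
    then have "(W\<^sup>T * W) $$ (i, j) = us ! i \<bullet> us ! j" using W colW by simp
    also have "\<dots> = (1 / nrm i) * ((1 / nrm j) * (ws ! i \<bullet> ws ! j))"
      using ij wsi[of i] wsi[of j] usi by simp
    also have "\<dots> = 1\<^sub>m n $$ (i, j)"
    proof (cases "i = j")
      case True
      have "nrm i * nrm i = ws ! i \<bullet> ws ! i" "nrm i \<noteq> 0" "ws ! i \<bullet> ws ! i \<noteq> 0"
        using nn[of i] orth[of i i] ij by (auto simp: nrm_def)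
      then show ?thesis using True ij by (simp add: field_simps)
    qed (use orth[of i j] ij in auto)
    finally show "(W\<^sup>T * W) $$ (i, j) = 1\<^sub>m n $$ (i, j)" .
  qed (use W in auto)
  moreover have "col W 0 = v"
    using colW[of 0] usi[of 0] n ws0 v1 by (simp add: nrm_def)
  ultimately show ?thesis using W by blast
qed

text \<open>The characteristic polynomial has a complex root; symmetry forces it to be real, and a
  real root has a real eigenvector, which is then normalised.\<close>

lemma real_symmetric_unit_eigenvector:
  fixes A :: "real mat"
  assumes A: "A \<in> carrier_mat n n" and sym: "A\<^sup>T = A" and n: "n \<noteq> 0"
  shows "\<exists>e v. v \<in> carrier_vec n \<and> v \<bullet> v = 1 \<and> A *\<^sub>v v = e \<cdot>\<^sub>v v"
proof -
  define C :: "complex mat" where "C = map_mat of_real A"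
  have C: "C \<in> carrier_mat n n" using A by (simp add: C_def)
  have Csym: "C\<^sup>T = C" using sym by (simp add: C_def map_mat_transpose)
  have cp: "char_poly C = map_poly of_real (char_poly A)" unfolding C_def by (rule of_real_hom.char_poly_hom[OF A])
  have "degree (char_poly C) = n" using degree_monic_char_poly[OF C] by simp
  then have "\<not> constant (poly (char_poly C))" using n by (simp add: constant_degree)
  then obtain z where z: "poly (char_poly C) z = 0" using fundamental_theorem_of_algebra by blast
  then obtain u where u: "u \<in> carrier_vec n" "u \<noteq> 0\<^sub>v n" and eig: "C *\<^sub>v u = z \<cdot>\<^sub>v u"
    using eigenvalue_root_char_poly[OF C] C unfolding eigenvalue_def eigenvector_def by auto
  let ?c = "conjugate u"
  have c: "?c \<in> carrier_vec n" using u by simp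
  have eigc: "C *\<^sub>v ?c = cnj z \<cdot>\<^sub>v ?c"
  proof (rule eq_vecI)
    fix i assume "i < dim_vec (cnj z \<cdot>\<^sub>v ?c)"
    then have i: "i < n" using u by auto
    have "(C *\<^sub>v ?c) $ i = cnj ((C *\<^sub>v u) $ i)"
      using i u(1) C A by (auto simp: C_def scalar_prod_def)
    then show "(C *\<^sub>v ?c) $ i = (cnj z \<cdot>\<^sub>v ?c) $ i"
      unfolding eig using i u(1) by simp
  qed (use C u in auto)
  have nz: "?c \<bullet> u \<noteq> 0"
    using conjugate_square_eq_0_vec[OF u(1)] u(2) comm_scalar_prod[OF c u(1)] by simp
  \<comment> \<open>The product is bilinear, so the explicit conjugate turns
    \<open>?c \<bullet> u\<close> into the squared norm of \<open>u\<close>. Moving the symmetric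
    matrix from one factor to the other multiplies it once by \<open>z\<close> and once by
    \<open>cnj z\<close>.\<close>
  have "z * (?c \<bullet> u) = ?c \<bullet> (C *\<^sub>v u)" using eig c u by simp
  also have "\<dots> = (C *\<^sub>v ?c) \<bullet> u"
    using transpose_vec_mult_scalar[OF C u(1) c] Csym comm_scalar_prod[OF c, of "C *\<^sub>v u"] C u c
      comm_scalar_prod[OF u(1), of "C *\<^sub>v ?c"]
    by simp
  also have "\<dots> = cnj z * (?c \<bullet> u)" using eigc c u by simp
  finally have "cnj z = z" using nz by simp
  then have "z = of_real (Re z)" by (metis Reals_cnj_iff of_real_Re)
  then have "poly (char_poly A) (Re z) = 0"
    using z unfolding cp by (metis of_real_hom.poly_map_poly of_real_eq_0_iff)
  then obtain w where w: "w \<in> carrier_vec n" "w \<noteq> 0\<^sub>v n" "A *\<^sub>v w = Re z \<cdot>\<^sub>v w"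
    using eigenvalue_root_char_poly[OF A] A unfolding eigenvalue_def eigenvector_def by auto
  have "w \<bullet> w \<ge> 0" by (simp add: scalar_prod_def sum_nonneg)
  moreover have "w \<bullet> w \<noteq> 0" using conjugate_square_eq_0_vec[OF w(1)] w(2) by simp
  ultimately have pos: "w \<bullet> w > 0" by simp
  define v where "v = (1 / sqrt (w \<bullet> w)) \<cdot>\<^sub>v w"
  have v: "v \<in> carrier_vec n" using w by (simp add: v_def)
  have "sqrt (w \<bullet> w) * sqrt (w \<bullet> w) = w \<bullet> w" using pos by simp
  then have "v \<bullet> v = 1" using w(1) pos by (simp add: v_def field_simps)
  moreover have "A *\<^sub>v v = Re z \<cdot>\<^sub>v v"
    unfolding v_def using mult_mat_vec[OF A w(1)] w(3) by (simp add: smult_smult_assoc mult.commute)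
  ultimately show ?thesis using v by blast
qed

text \<open>\<open>\<phi> i x\<close> stands for the \<open>i\<close>-th coordinate of
  \<open>x\<close> in an orthonormal eigenbasis. Only what a Rayleigh quotient needs is recorded:
  linearity, the Parseval identity and the diagonal form.\<close>

definition diagonalises :: "real mat \<Rightarrow> nat \<Rightarrow> real list \<Rightarrow> (nat \<Rightarrow> real vec \<Rightarrow> real) \<Rightarrow> bool" where
  "diagonalises A n es \<phi> \<longleftrightarrow>
    (\<forall>i<n. \<forall>x\<in>carrier_vec n. \<forall>y\<in>carrier_vec n. \<forall>a b.
       \<phi> i (a \<cdot>\<^sub>v x + b \<cdot>\<^sub>v y) = a * \<phi> i x + b * \<phi> i y) \<and>
    (\<forall>x\<in>carrier_vec n. x \<bullet> x = (\<Sum>i<n. (\<phi> i x)\<^sup>2)) \<and>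
    (\<forall>x\<in>carrier_vec n. x \<bullet> (A *\<^sub>v x) = (\<Sum>i<n. es ! i * (\<phi> i x)\<^sup>2))"

text \<open>Induction by deflation: an orthogonal change of basis with a unit eigenvector in front
  makes the matrix block diagonal. The factorisation of \<open>char_poly A\<close> is carried along
  to identify \<open>es\<close> with the roots, multiplicities included.\<close>

theorem symmetric_form_diagonalisation:
  fixes A :: "real mat"
  assumes "A \<in> carrier_mat n n" and "A\<^sup>T = A"
  shows "\<exists>es \<phi>. length es = n \<and> char_poly A = (\<Prod>e\<leftarrow>es. [:- e, 1:]) \<and>
    diagonalises A n es \<phi>"
  using assms
proof (induction n arbitrary: A)
  case 0
  then have "char_poly A = 1"
    using degree_monic_char_poly[OF 0(1)] by (metis monic_degree_0)
  then show ?case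
    using 0 by (intro exI[of _ "[]"] exI[of _ "\<lambda>_ _. 0"]) (auto simp: diagonalises_def scalar_prod_def)
next
  case (Suc m)
  let ?n = "Suc m"
  note A = Suc.prems(1)
  obtain e v where v: "v \<in> carrier_vec ?n" "v \<bullet> v = 1" and eig: "A *\<^sub>v v = e \<cdot>\<^sub>v v"
    using real_symmetric_unit_eigenvector[OF Suc.prems] by auto
  obtain W where W: "W \<in> carrier_mat ?n ?n" and WW: "W\<^sup>T * W = 1\<^sub>m ?n" and col0: "col W 0 = v"
    using orthogonal_matrix_with_first_column[OF v] by auto
  have WT: "W\<^sup>T \<in> carrier_mat ?n ?n" using W by simp
  have WW': "W * W\<^sup>T = 1\<^sub>m ?n" using mat_mult_left_right_inverse[OF WT W WW] .
  define B where "B = W\<^sup>T * (A * W)"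
  have B: "B \<in> carrier_mat ?n ?n" using A W by (simp add: B_def)
  have Bsym: "B\<^sup>T = B"
  proof -
    have "B\<^sup>T = (A * W)\<^sup>T * W\<^sup>T\<^sup>T" unfolding B_def using A W by (intro transpose_mult) auto
    also have "(A * W)\<^sup>T = W\<^sup>T * A\<^sup>T" using A W by (intro transpose_mult) auto
    finally show ?thesis using Suc.prems W A by (simp add: B_def)
  qed
  \<comment> \<open>The first column of \<open>W\<close> is the eigenvector, which
    \<open>W\<^sup>T\<close> sends to the first unit vector. Symmetry of \<open>B\<close> later
    clears the first row as well.\<close>
  have Bcol: "B $$ (i, 0) = (if i = 0 then e else 0)" if i: "i < ?n" for i
  proof -
    have "B $$ (i, 0) = col B 0 $ i" using B i by simp
    also have "col B 0 = W\<^sup>T *\<^sub>v (A *\<^sub>v col W 0)"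
      unfolding B_def using col_mult2[OF WT, of "A * W" ?n 0] col_mult2[OF A W, of 0] A W by simp
    also have "\<dots> = e \<cdot>\<^sub>v (W\<^sup>T *\<^sub>v col W 0)"
      unfolding col0 eig using mult_mat_vec[OF WT v(1)] .
    also have "W\<^sup>T *\<^sub>v col W 0 = col (W\<^sup>T * W) 0" using col_mult2[OF WT W, of 0] by simp
    finally show ?thesis using i by (simp add: WW)
  qed
  define D where "D = mat m m (\<lambda>(i, j). B $$ (Suc i, Suc j))"
  have D: "D \<in> carrier_mat m m" by (simp add: D_def)
  have Bs: "B $$ (i, j) = B $$ (j, i)" if "i < ?n" "j < ?n" for i j
    using arg_cong[OF Bsym, of "\<lambda>M. M $$ (i, j)"] that B by simp
  have "D\<^sup>T = D" by (rule eq_matI) (auto simp: D_def Bs)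
  from Suc.IH[OF D this] obtain es \<phi> where len: "length es = m"
    and cpD: "char_poly D = (\<Prod>e\<leftarrow>es. [:- e, 1:])" and diag: "diagonalises D m es \<phi>"
    by blast
  have lin: "\<phi> i (a \<cdot>\<^sub>v x + b \<cdot>\<^sub>v y) = a * \<phi> i x + b * \<phi> i y"
    if "i < m" "x \<in> carrier_vec m" "y \<in> carrier_vec m" for i x y a b
    using diag that by (simp add: diagonalises_def)
  have sq: "x \<bullet> x = (\<Sum>i<m. (\<phi> i x)\<^sup>2)"
    and form: "x \<bullet> (D *\<^sub>v x) = (\<Sum>i<m. es ! i * (\<phi> i x)\<^sup>2)" if "x \<in> carrier_vec m" for x
    using diag that by (simp_all add: diagonalises_def)
  have Bblock: "B = four_block_mat (mat 1 1 (\<lambda>_. e)) (0\<^sub>m 1 m) (0\<^sub>m m 1) D"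
  proof (rule eq_matI)
    fix i j assume "i < dim_row (four_block_mat (mat 1 1 (\<lambda>_. e)) (0\<^sub>m 1 m) (0\<^sub>m m 1) D)"
      "j < dim_col (four_block_mat (mat 1 1 (\<lambda>_. e)) (0\<^sub>m 1 m) (0\<^sub>m m 1) D)"
    then have ij: "i < ?n" "j < ?n" using D by auto
    show "B $$ (i, j) = four_block_mat (mat 1 1 (\<lambda>_. e)) (0\<^sub>m 1 m) (0\<^sub>m m 1) D $$ (i, j)"
      using ij D Bcol[of i] Bcol[of j] Bs[of 0 j] by (cases i; cases j) (auto simp: D_def)
  qed (use B D in auto)
  have "similar_mat_wit B A W\<^sup>T W"
    by (rule similar_mat_witI[of _ _ ?n]) (use W A B WW WW' in \<open>auto simp: B_def\<close>)
  then have "char_poly A = char_poly B" using char_poly_similar[of B A] unfolding similar_mat_def by metis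
  also have "\<dots> = char_poly (mat 1 1 (\<lambda>_. e)) * char_poly D"
    unfolding Bblock by (rule char_poly_four_block_zeros_col) (use D in auto)
  also have "char_poly (mat 1 1 (\<lambda>_. e)) = [:- e, 1:]"
    by (simp add: char_poly_defs det_def sign_def)
  finally have cpA: "char_poly A = (\<Prod>e\<leftarrow>e # es. [:- e, 1:])" using cpD by simp
  define rest where "rest x = vec_last (W\<^sup>T *\<^sub>v x) m" for x
  \<comment> \<open>After the rotation by \<open>W\<^sup>T\<close> the first entry is the coordinate
    belonging to \<open>e\<close>, and the other \<open>m\<close> entries are handed to the
    coordinates of \<open>D\<close>.\<close>
  define \<psi> where "\<psi> i x = (case i of 0 \<Rightarrow> (W\<^sup>T *\<^sub>v x) $ 0 | Suc i \<Rightarrow> \<phi> i (rest x))" for i x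
  have lin': "\<psi> i (a \<cdot>\<^sub>v x + b \<cdot>\<^sub>v y) = a * \<psi> i x + b * \<psi> i y"
    if "i < ?n" and xy: "x \<in> carrier_vec ?n" "y \<in> carrier_vec ?n" for i x y a b
  proof -
    have *: "W\<^sup>T *\<^sub>v (a \<cdot>\<^sub>v x + b \<cdot>\<^sub>v y) = a \<cdot>\<^sub>v (W\<^sup>T *\<^sub>v x) + b \<cdot>\<^sub>v (W\<^sup>T *\<^sub>v y)"
      using mult_add_distrib_mat_vec[OF WT, of "a \<cdot>\<^sub>v x" "b \<cdot>\<^sub>v y"] mult_mat_vec[OF WT] xy by simp
    have "rest (a \<cdot>\<^sub>v x + b \<cdot>\<^sub>v y) = a \<cdot>\<^sub>v rest x + b \<cdot>\<^sub>v rest y"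
      unfolding rest_def * using W by (intro eq_vecI) (auto simp: vec_last_def)
    then show ?thesis
      using that * lin[of "i - 1" "rest x" "rest y"] W by (cases i) (auto simp: \<psi>_def rest_def)
  qed
  have split: "x \<bullet> x = (\<psi> 0 x)\<^sup>2 + rest x \<bullet> rest x \<and>
      x \<bullet> (A *\<^sub>v x) = e * (\<psi> 0 x)\<^sup>2 + rest x \<bullet> (D *\<^sub>v rest x)" if x: "x \<in> carrier_vec ?n" for x
  proof -
    define y where "y = W\<^sup>T *\<^sub>v x"
    have y: "y \<in> carrier_vec ?n" using WT x by (simp add: y_def)
    have xy: "x = W *\<^sub>v y"
      using assoc_mult_mat_vec[OF W WT x] x by (simp add: y_def WW')
    have dot: "x \<bullet> t = y \<bullet> (W\<^sup>T *\<^sub>v t)" if t: "t \<in> carrier_vec ?n" for t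
      using transpose_vec_mult_scalar[OF W y t] comm_scalar_prod[OF x t]
        comm_scalar_prod[OF y, of "W\<^sup>T *\<^sub>v t"] WT t
      by (simp add: xy)
    define f where "f = vec_first y 1"
    have yf: "y = f @\<^sub>v rest x"
      using vec_first_last_append[of y 1 m] y by (simp add: f_def rest_def y_def)
    have f: "f \<in> carrier_vec 1" by (simp add: f_def)
    have r: "rest x \<in> carrier_vec m" by (simp add: rest_def)
    have f0: "f $ 0 = \<psi> 0 x" by (simp add: f_def \<psi>_def y_def vec_first_def)
    have "x \<bullet> x = y \<bullet> y" using dot[OF x] by (simp add: y_def)
    also have "\<dots> = f \<bullet> f + rest x \<bullet> rest x" unfolding yf by (rule scalar_prod_append[OF f r f r])
    also have "f \<bullet> f = (\<psi> 0 x)\<^sup>2" using f by (simp add: scalar_prod_def f0 power2_eq_square)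
    finally have 1: "x \<bullet> x = (\<psi> 0 x)\<^sup>2 + rest x \<bullet> rest x" .
    have "x \<bullet> (A *\<^sub>v x) = y \<bullet> (W\<^sup>T *\<^sub>v (A *\<^sub>v x))" using dot[of "A *\<^sub>v x"] A x by simp
    also have "W\<^sup>T *\<^sub>v (A *\<^sub>v x) = B *\<^sub>v y"
      unfolding B_def using assoc_mult_mat_vec[OF WT _ y, of "A * W"] assoc_mult_mat_vec[OF A W y] A W
      by (simp add: xy)
    also have "\<dots> = (mat 1 1 (\<lambda>_. e) *\<^sub>v f) @\<^sub>v (D *\<^sub>v rest x)"
      unfolding Bblock yf by (rule mult_mat_vec_split[OF _ D f r]) auto
    also have "y \<bullet> \<dots> = f \<bullet> (mat 1 1 (\<lambda>_. e) *\<^sub>v f) + rest x \<bullet> (D *\<^sub>v rest x)"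
      unfolding yf using D r f by (intro scalar_prod_append[of _ 1 _ m] mult_mat_vec_carrier[of _ 1 1]) auto
    also have "f \<bullet> (mat 1 1 (\<lambda>_. e) *\<^sub>v f) = e * (\<psi> 0 x)\<^sup>2"
      using f by (simp add: scalar_prod_def f0 power2_eq_square)
    finally show ?thesis using 1 by simp
  qed
  have "rest x \<in> carrier_vec m" for x by (simp add: rest_def)
  then have "x \<bullet> x = (\<Sum>i<?n. (\<psi> i x)\<^sup>2)"
    and "x \<bullet> (A *\<^sub>v x) = (\<Sum>i<?n. (e # es) ! i * (\<psi> i x)\<^sup>2)" if "x \<in> carrier_vec ?n" for x
    using split[OF that] sq form unfolding sum.lessThan_Suc_shift by (simp_all add: \<psi>_def)
  then show ?case using len cpA lin' by (intro exI[of _ "e # es"] exI[of _ \<psi>]) (simp add: diagonalises_def)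
qed

section \<open>A lower bound for the second largest eigenvalue\<close>

text \<open>One half of the Courant-Fischer principle for a plane; \<open>pos\<close> expresses that
  \<open>x\<close> and \<open>y\<close> are independent. If at most one eigenvalue reached
  \<open>\<mu>\<close>, a nonzero vector of the plane would have no component along it and a
  Rayleigh quotient below \<open>\<mu>\<close>.\<close>

lemma second_largest_root_ge:
  fixes A :: "real mat"
  assumes A: "A \<in> carrier_mat n n" "A\<^sup>T = A" and n: "2 \<le> n"
    and x: "x \<in> carrier_vec n" and y: "y \<in> carrier_vec n"
    and pos: "\<And>a b z. z = a \<cdot>\<^sub>v x + b \<cdot>\<^sub>v y \<Longrightarrow> a \<noteq> 0 \<or> b \<noteq> 0 \<Longrightarrow> 0 < z \<bullet> z"
    and rayleigh: "\<And>a b z. z = a \<cdot>\<^sub>v x + b \<cdot>\<^sub>v y \<Longrightarrow> \<mu> * (z \<bullet> z) \<le> z \<bullet> (A *\<^sub>v z)"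
  shows "\<mu> \<le> rev (sorted_list_of_multiset (proots (char_poly A))) ! 1"
proof (rule ccontr)
  define ds where "ds = rev (sorted_list_of_multiset (proots (char_poly A)))"
  assume "\<not> \<mu> \<le> rev (sorted_list_of_multiset (proots (char_poly A))) ! 1"
  then have small: "ds ! 1 < \<mu>" by (simp add: ds_def)
  obtain es \<phi> where len: "length es = n"
    and cp: "char_poly A = (\<Prod>e\<leftarrow>es. [:- e, 1:])" and diag: "diagonalises A n es \<phi>"
    using symmetric_form_diagonalisation[OF A] by blast
  have lin: "\<phi> i (a \<cdot>\<^sub>v x + b \<cdot>\<^sub>v y) = a * \<phi> i x + b * \<phi> i y"
    if "i < n" "x \<in> carrier_vec n" "y \<in> carrier_vec n" for i x y a b
    using diag that by (simp add: diagonalises_def)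
  have sq: "x \<bullet> x = (\<Sum>i<n. (\<phi> i x)\<^sup>2)"
    and form: "x \<bullet> (A *\<^sub>v x) = (\<Sum>i<n. es ! i * (\<phi> i x)\<^sup>2)" if "x \<in> carrier_vec n" for x
    using diag that by (simp_all add: diagonalises_def)
  have "proots (\<Prod>e\<leftarrow>es. [:- e, 1:]) = mset es" for es :: "real list"
  proof (induction es)
    case (Cons e es)
    have "(\<Prod>e\<leftarrow>es. [:- e, 1:]) \<noteq> 0" by (auto simp: prod_list_zero_iff)
    then show ?case using Cons proots_mult[of "[:- e, 1:]" "\<Prod>e\<leftarrow>es. [:- e, 1:]"] by simp
  qed simp
  then have ms: "mset ds = mset es" by (simp add: ds_def cp)
  then have lends: "length ds = n" using len by (metis size_mset)
  have sorted: "sorted (rev ds)" by (simp add: ds_def)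
  have ds_small: "ds ! k < \<mu>" if "1 \<le> k" "k < n" for k
  proof -
    have "ds ! k \<le> ds ! 1" using sorted_rev_nth_mono[OF sorted] that lends by simp
    then show ?thesis using small by simp
  qed
  let ?P = "\<lambda>e. \<mu> \<le> e"
  \<comment> \<open>The list \<open>es\<close> is in no particular order, but shares its multiset
    with the sorted list \<open>ds\<close>, where only position 0 can reach
    \<open>\<mu>\<close>.\<close>
  have "card {i. i < n \<and> ?P (es ! i)} = size (filter_mset ?P (mset es))"
    using length_filter_conv_card[of ?P es] len by (simp flip: mset_filter)
  also have "\<dots> = card {i. i < n \<and> ?P (ds ! i)}"
    unfolding ms[symmetric] using length_filter_conv_card[of ?P ds] lends by (simp flip: mset_filter)
  also have "\<dots> \<le> card {0 :: nat}"
    by (rule card_mono) (use ds_small in \<open>force simp: not_le\<close>)+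
  finally have le1: "card {i. i < n \<and> ?P (es ! i)} \<le> Suc 0" by simp
  have "\<exists>k<n. \<forall>i<n. i \<noteq> k \<longrightarrow> es ! i < \<mu>"
  proof (cases "\<exists>k<n. ?P (es ! k)")
    case True
    then obtain k where k: "k < n" "?P (es ! k)" by auto
    have "i = k" if "i < n" "?P (es ! i)" for i
      using le1 that k by (auto simp: card_le_Suc0_iff_eq)
    then show ?thesis using k by (meson not_le)
  next
    case False
    then show ?thesis using n by (intro exI[of _ 0]) auto
  qed
  then obtain k where k: "k < n" and ks: "\<And>i. i < n \<Longrightarrow> i \<noteq> k \<Longrightarrow> es ! i < \<mu>" by auto
  \<comment> \<open>Two coefficients against one linear condition: some nontrivial combination has
    vanishing \<open>k\<close>-th coordinate.\<close>
  obtain a b where ab: "a \<noteq> 0 \<or> b \<noteq> 0" "a * \<phi> k x + b * \<phi> k y = 0"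
  proof (cases "\<phi> k x = 0")
    case True
    then show ?thesis using that[of 1 0] by simp
  next
    case False
    then show ?thesis using that[of "\<phi> k y" "- \<phi> k x"] by simp
  qed
  define z where "z = a \<cdot>\<^sub>v x + b \<cdot>\<^sub>v y"
  have z: "z \<in> carrier_vec n" using x y by (simp add: z_def)
  have zk: "\<phi> k z = 0" using lin[OF k x y] ab by (simp add: z_def)
  \<comment> \<open>Some other coordinate of \<open>z\<close> is nonzero, and it makes the
    comparison of the two sums strict.\<close>
  have "0 < (\<Sum>i<n. (\<phi> i z)\<^sup>2)" using pos[OF z_def ab(1)] sq[OF z] by simp
  then obtain j where j: "j < n" "\<phi> j z \<noteq> 0"
    by (metis (no_types, lifting) lessThan_iff less_irrefl power_zero_numeral sum.neutral)
  then have "j \<noteq> k" using zk by auto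
  have "(\<Sum>i<n. es ! i * (\<phi> i z)\<^sup>2) < (\<Sum>i<n. \<mu> * (\<phi> i z)\<^sup>2)"
  proof (rule sum_strict_mono_ex1)
    show "\<forall>i\<in>{..<n}. es ! i * (\<phi> i z)\<^sup>2 \<le> \<mu> * (\<phi> i z)\<^sup>2"
    proof
      fix i assume "i \<in> {..<n}"
      then show "es ! i * (\<phi> i z)\<^sup>2 \<le> \<mu> * (\<phi> i z)\<^sup>2"
        using ks[of i] zk by (cases "i = k") (auto intro: mult_right_mono)
    qed
    show "\<exists>i\<in>{..<n}. es ! i * (\<phi> i z)\<^sup>2 < \<mu> * (\<phi> i z)\<^sup>2"
      using j ks[OF j(1) \<open>j \<noteq> k\<close>] by (intro bexI[of _ j]) auto
  qed simp
  then have "z \<bullet> (A *\<^sub>v z) < \<mu> * (z \<bullet> z)"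
    using form[OF z] sq[OF z] by (simp add: sum_distrib_left)
  then show False using rayleigh[OF z_def] by simp
qed

section \<open>Edge counts and the second eigenvalue\<close>

text \<open>Ordered pairs are counted: for disjoint sets this is the number of edges between them,
  while without loops an edge inside \<open>X\<close> counts twice in \<open>arcs E X X\<close>. So
  this is the adjacency form evaluated on indicator vectors.\<close>

definition arcs :: "'a set set \<Rightarrow> 'a set \<Rightarrow> 'a set \<Rightarrow> nat" where
  "arcs E X Y = (\<Sum>u\<in>X. \<Sum>v\<in>Y. of_bool ({u, v} \<in> E))"

lemma arcs_sym: "arcs E X Y = arcs E Y X"
  unfolding arcs_def by (subst sum.swap) (simp add: insert_commute)

lemma arcs_Un_right:
  assumes "finite Y" "finite Z" "Y \<inter> Z = {}"
  shows "arcs E X (Y \<union> Z) = arcs E X Y + arcs E X Z"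
  unfolding arcs_def sum.distrib[symmetric] using assms by (intro sum.cong sum.union_disjoint refl)

lemma arcs_mono_right: "finite Z \<Longrightarrow> Y \<subseteq> Z \<Longrightarrow> arcs E X Y \<le> arcs E X Z"
  unfolding arcs_def by (intro sum_mono sum_mono2) auto

lemma arcs_Union_right:
  assumes "finite P" "\<And>Y. Y \<in> P \<Longrightarrow> finite Y" "\<And>Y Z. Y \<in> P \<Longrightarrow> Z \<in> P \<Longrightarrow> Y \<noteq> Z \<Longrightarrow> Y \<inter> Z = {}"
  shows "arcs E X (\<Union>P) = (\<Sum>Y\<in>P. arcs E X Y)"
proof -
  have "arcs E X (\<Union>P) = (\<Sum>u\<in>X. \<Sum>Y\<in>P. \<Sum>v\<in>Y. of_bool ({u, v} \<in> E))"
    unfolding arcs_def using assms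
    by (intro sum.cong refl trans[OF sum.Union_disjoint]) (auto simp only: comp_def)
  also have "\<dots> = (\<Sum>Y\<in>P. arcs E X Y)" unfolding arcs_def by (rule sum.swap)
  finally show ?thesis .
qed

lemma arcs_eq_card:
  assumes "finite X" "finite Y"
  shows "arcs E X Y = card {(u, v) \<in> X \<times> Y. {u, v} \<in> E}"
proof -
  have "arcs E X Y = (\<Sum>p\<in>X \<times> Y. of_bool ({fst p, snd p} \<in> E))"
    unfolding arcs_def by (simp add: sum.cartesian_product case_prod_beta)
  also have "\<dots> = card {p \<in> X \<times> Y. {fst p, snd p} \<in> E}"
    using assms by (simp add: sum.If_cases of_bool_def Int_def)
  also have "{p \<in> X \<times> Y. {fst p, snd p} \<in> E} = {(u, v) \<in> X \<times> Y. {u, v} \<in> E}" by auto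
  finally show ?thesis .
qed

section \<open>Boundaries of vertex sets in a regular graph\<close>

locale regular_simple_graph =
  fixes V :: "'a set" and E :: "'a set set" and d :: nat
  assumes simple: "simple_graph V E" and regular: "regular_graph d V E"
begin

lemma finV: "finite V" and edge: "e \<in> E \<Longrightarrow> e \<subseteq> V \<and> card e = 2"
  using simple by (auto simp: simple_graph_def)

lemma finE: "finite E"
proof -
  have "E \<subseteq> Pow V" using edge by blast
  then show ?thesis using finV by (simp add: finite_subset)
qed

lemma no_loop: "{u} \<notin> E"
  using edge[of "{u}"] by auto

lemma degree_sum:
  assumes u: "u \<in> V"
  shows "(\<Sum>v\<in>V. of_bool ({u, v} \<in> E)) = d"
proof -
  have "bij_betw (\<lambda>v. {u, v}) {v \<in> V. {u, v} \<in> E} {e \<in> E. u \<in> e}"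
  proof (rule bij_betwI')
    fix e assume e: "e \<in> {e \<in> E. u \<in> e}"
    then obtain a b where "e = {a, b}" "a \<in> V" "b \<in> V" using edge[of e] by (auto simp: card_2_iff)
    then show "\<exists>v\<in>{v \<in> V. {u, v} \<in> E}. e = {u, v}" using e by (auto simp: insert_commute)
  qed (auto simp: doubleton_eq_iff)
  then have "card {v \<in> V. {u, v} \<in> E} = d"
    using regular u unfolding regular_graph_def vertex_degree_def by (auto dest: bij_betw_same_card)
  then show ?thesis using finV by (simp add: sum.If_cases of_bool_def Int_def)
qed

lemma arcs_V: "X \<subseteq> V \<Longrightarrow> arcs E X V = d * card X"
  unfolding arcs_def using degree_sum by (simp add: subset_iff)

lemma arcs_self_boundary:
  assumes "X \<subseteq> V"
  shows "arcs E X X + arcs E X (V - X) = d * card X"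
  using arcs_Un_right[of X "V - X" E X] arcs_V[OF assms] finV assms
  by (auto simp: Un_absorb1 finite_subset)

lemma arcs_self_le:
  assumes "X \<subseteq> V"
  shows "arcs E X X \<le> card X * (card X - 1)"
proof -
  have "arcs E X X \<le> (\<Sum>u\<in>X. card X - 1)"
    unfolding arcs_def
  proof (rule sum_mono)
    fix u assume u: "u \<in> X"
    have fin: "finite X" using assms finV by (rule finite_subset)
    have "(\<Sum>v\<in>X. of_bool ({u, v} \<in> E)) = (\<Sum>v\<in>X - {u}. of_bool ({u, v} \<in> E) :: nat)"
      using fin u no_loop by (intro sum.mono_neutral_right) auto
    also have "\<dots> \<le> (\<Sum>v\<in>X - {u}. 1)" by (rule sum_mono) simp
    finally show "(\<Sum>v\<in>X. of_bool ({u, v} \<in> E)) \<le> card X - 1" using fin u by simp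
  qed
  then show ?thesis by simp
qed

text \<open>A vertex of \<open>X\<close> has at most \<open>card X - 1\<close> neighbours inside, so
  the boundary is at least \<open>card X * (d - card X + 1)\<close>, which is at least
  \<open>d\<close> when \<open>1 \<le> card X \<le> d\<close>.\<close>

lemma small_boundary_card:
  assumes "X \<subseteq> V" "X \<noteq> {}" "arcs E X (V - X) < d"
  shows "d + 1 \<le> card X"
proof (rule ccontr)
  assume "\<not> d + 1 \<le> card X"
  then have le: "card X \<le> d" by simp
  have "card X > 0" using assms finV by (meson card_gt_0_iff finite_subset)
  then obtain k where k: "card X = Suc k" by (cases "card X") auto
  have "d * Suc k < Suc k * k + d"
    using arcs_self_boundary[OF assms(1)] arcs_self_le[OF assms(1)] assms(3) k by simp
  then have "d * k < Suc k * k" by simp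
  then have "d < Suc k" by (metis mult_less_cancel2)
  then show False using le k by simp
qed

text \<open>The test plane is spanned by the two indicator vectors. Its cross term can cost up to
  \<open>arcs E X Y\<close> on each diagonal term, which is why that count is added to both
  boundaries.\<close>

lemma two_sets_second_eigenvalue:
  fixes c :: real
  assumes X: "X \<subseteq> V" "X \<noteq> {}" and Y: "Y \<subseteq> V" "Y \<noteq> {}" and XY: "X \<inter> Y = {}"
    and bX: "real (arcs E X (V - X) + arcs E X Y) \<le> c * card X"
    and bY: "real (arcs E Y (V - Y) + arcs E X Y) \<le> c * card Y"
  shows "real d - c \<le> graph_eigenvalue V E 2"
proof -
  define vs where "vs = vertex_enum V"
  define n where "n = length vs"
  define A where "A = adjacency_matrix vs E"
  have vs: "distinct vs" "set vs = V" using vertex_enum[OF finV] by (auto simp: vs_def)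
  have cardV: "card V = n" using distinct_card[OF vs(1)] vs(2) by (simp add: n_def)
  have fin: "finite X" "finite Y" using X Y finV by (auto intro: finite_subset)
  have sum_vs: "(\<Sum>i<n. g (vs ! i)) = (\<Sum>v\<in>V. g v)" for g :: "'a \<Rightarrow> real"
  proof -
    have "bij_betw (nth vs) {..<n} V"
      using bij_betw_nth[OF vs(1), of "{..<n}" V] vs(2) by (auto simp: n_def)
    then show ?thesis by (rule sum.reindex_bij_betw)
  qed
  have A: "A \<in> carrier_mat n n" by (simp add: A_def adjacency_matrix_def n_def)
  have AT: "A\<^sup>T = A"
    by (rule eq_matI) (auto simp: A_def adjacency_matrix_def insert_commute)
  define ix where "ix Z = vec n (\<lambda>i. of_bool (vs ! i \<in> Z) :: real)" for Z
  have ix: "ix Z \<in> carrier_vec n" for Z by (simp add: ix_def)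
  have dot: "ix Z \<bullet> ix Z' = card (Z \<inter> Z')" if "Z \<subseteq> V" "Z' \<subseteq> V" for Z Z'
  proof -
    have "ix Z \<bullet> ix Z' = (\<Sum>i<n. of_bool (vs ! i \<in> Z \<inter> Z'))"
      by (simp add: ix_def scalar_prod_def lessThan_atLeast0 flip: of_bool_conj)
    also have "\<dots> = (\<Sum>v\<in>V. of_bool (v \<in> Z \<inter> Z'))" by (rule sum_vs)
    also have "\<dots> = card (V \<inter> (Z \<inter> Z'))" using finV by (simp add: sum.If_cases of_bool_def Int_def)
    also have "V \<inter> (Z \<inter> Z') = Z \<inter> Z'" using that by auto
    finally show ?thesis .
  qed
  have form: "ix Z \<bullet> (A *\<^sub>v ix Z') = arcs E Z Z'" if "Z \<subseteq> V" "Z' \<subseteq> V" for Z Z'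
  proof -
    have row: "(A *\<^sub>v ix Z') $ i = (\<Sum>j<n. of_bool ({vs ! i, vs ! j} \<in> E) * of_bool (vs ! j \<in> Z'))"
      if "i < n" for i
    proof -
      have "(A *\<^sub>v ix Z') $ i = (\<Sum>j<n. A $$ (i, j) * ix Z' $ j)"
        using A that by (simp add: scalar_prod_def lessThan_atLeast0 ix_def[of Z'])
      also have "\<dots> = (\<Sum>j<n. of_bool ({vs ! i, vs ! j} \<in> E) * of_bool (vs ! j \<in> Z'))"
        using that by (intro sum.cong) (auto simp: A_def adjacency_matrix_def n_def ix_def)
      finally show ?thesis .
    qed
    have "ix Z \<bullet> (A *\<^sub>v ix Z') = (\<Sum>i<n. ix Z $ i * (A *\<^sub>v ix Z') $ i)"
      using A by (simp add: scalar_prod_def lessThan_atLeast0)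
    also have "\<dots> =
        (\<Sum>i<n. of_bool (vs ! i \<in> Z) * (\<Sum>j<n. of_bool ({vs ! i, vs ! j} \<in> E) * of_bool (vs ! j \<in> Z')))"
      using row by (intro sum.cong) (auto simp only: ix_def lessThan_iff index_vec)
    also have "\<dots> = (\<Sum>u\<in>V. of_bool (u \<in> Z) * (\<Sum>v\<in>V. of_bool ({u, v} \<in> E) * of_bool (v \<in> Z')))"
      unfolding sum_vs[of "\<lambda>v. of_bool ({vs ! i, v} \<in> E) * of_bool (v \<in> Z')" for i]
      by (rule sum_vs)
    also have "\<dots> = (\<Sum>u\<in>Z. \<Sum>v\<in>V. of_bool ({u, v} \<in> E) * of_bool (v \<in> Z'))"
      using that finV by (intro sum.mono_neutral_cong_right) auto
    also have "\<dots> = (\<Sum>u\<in>Z. \<Sum>v\<in>Z'. of_bool ({u, v} \<in> E))"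
      using that finV by (intro sum.cong sum.mono_neutral_cong_right refl) auto
    finally show ?thesis by (simp add: arcs_def)
  qed
  define x where "x = ix X"
  define y where "y = ix Y"
  have x: "x \<in> carrier_vec n" and y: "y \<in> carrier_vec n" by (simp_all add: x_def y_def ix)
  have Ax: "A *\<^sub>v x \<in> carrier_vec n" and Ay: "A *\<^sub>v y \<in> carrier_vec n" using A x y by simp_all
  let ?z = "\<lambda>a b. a \<cdot>\<^sub>v x + b \<cdot>\<^sub>v y"
  have zz: "?z a b \<bullet> ?z a b = a\<^sup>2 * card X + b\<^sup>2 * card Y" for a b
  proof -
    have "?z a b \<bullet> ?z a b = a * a * (x \<bullet> x) + a * b * (x \<bullet> y) + b * a * (y \<bullet> x) + b * b * (y \<bullet> y)"
      using x y by (simp add: add_scalar_prod_distrib[of _ n] scalar_prod_add_distrib[of _ n] algebra_simps)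
    moreover have "x \<bullet> x = card X" "y \<bullet> y = card Y" "x \<bullet> y = 0" "y \<bullet> x = 0"
      using dot X Y XY by (auto simp: x_def y_def Int_commute)
    ultimately show ?thesis by (simp add: power2_eq_square)
  qed
  have zAz: "?z a b \<bullet> (A *\<^sub>v ?z a b) = a\<^sup>2 * arcs E X X + 2 * a * b * arcs E X Y + b\<^sup>2 * arcs E Y Y" for a b
  proof -
    have "A *\<^sub>v ?z a b = a \<cdot>\<^sub>v (A *\<^sub>v x) + b \<cdot>\<^sub>v (A *\<^sub>v y)"
      using mult_add_distrib_mat_vec[OF A, of "a \<cdot>\<^sub>v x" "b \<cdot>\<^sub>v y"] mult_mat_vec[OF A] x y by simp
    then have "?z a b \<bullet> (A *\<^sub>v ?z a b) = a * a * (x \<bullet> (A *\<^sub>v x)) + a * b * (x \<bullet> (A *\<^sub>v y)) +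
        b * a * (y \<bullet> (A *\<^sub>v x)) + b * b * (y \<bullet> (A *\<^sub>v y))"
      using x y Ax Ay by (simp add: add_scalar_prod_distrib[of _ n] scalar_prod_add_distrib[of _ n] algebra_simps)
    then show ?thesis
      using form X Y arcs_sym[of E X Y] by (simp add: x_def y_def power2_eq_square)
  qed
  have "real d - c \<le> rev (sorted_list_of_multiset (proots (char_poly A))) ! 1"
  proof (rule second_largest_root_ge[OF A AT _ x y])
    have "card X > 0" "card Y > 0" using X Y fin by (auto simp: card_gt_0_iff)
    moreover have "card (X \<union> Y) \<le> card V" using X Y finV by (intro card_mono) auto
    ultimately show "2 \<le> n" using fin XY cardV by (simp add: card_Un_disjoint)
    fix a b z assume z: "z = ?z a b"
    show "0 < z \<bullet> z" if "a \<noteq> 0 \<or> b \<noteq> 0"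
      using that \<open>card X > 0\<close> \<open>card Y > 0\<close> unfolding z zz
      by (auto simp: add_pos_nonneg add_nonneg_pos)
    have sX: "real (arcs E X X) + real (arcs E X (V - X)) = real d * card X"
      using arcs_self_boundary[OF X(1)] by (metis of_nat_add of_nat_mult)
    have sY: "real (arcs E Y Y) + real (arcs E Y (V - Y)) = real d * card Y"
      using arcs_self_boundary[OF Y(1)] by (metis of_nat_add of_nat_mult)
    have 1: "a\<^sup>2 * ((real d - c) * card X) \<le> a\<^sup>2 * (real (arcs E X X) - arcs E X Y)"
      using sX bX by (intro mult_left_mono) (auto simp: algebra_simps)
    have 2: "b\<^sup>2 * ((real d - c) * card Y) \<le> b\<^sup>2 * (real (arcs E Y Y) - arcs E X Y)"
      using sY bY by (intro mult_left_mono) (auto simp: algebra_simps)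
    \<comment> \<open>This bounds the cross term \<open>2 * a * b * arcs E X Y\<close> from below by
      \<open>- (a\<^sup>2 + b\<^sup>2) * arcs E X Y\<close>, the amount set aside in the two
      preceding inequalities.\<close>
    have 3: "0 \<le> (a + b)\<^sup>2 * arcs E X Y" by simp
    show "(real d - c) * (z \<bullet> z) \<le> z \<bullet> (A *\<^sub>v z)"
      unfolding z zz zAz using 1 2 3 by (simp add: power2_sum algebra_simps)
  qed
  then show ?thesis
    by (simp add: graph_eigenvalue_def adjacency_eigenvalues_def A_def vs_def)
qed

text \<open>The parts with boundary at most three have total deficiency \<open>4 - r\<close> at least six. If they
  were pairwise joined, \<open>m\<close> of them would each have boundary at least \<open>m - 1\<close>, so that
  \<open>m (5 - m) \<ge> 6\<close>; this leaves \<open>m = 2, 3\<close> with a single edge between any two of them.\<close>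

lemma weakly_joined_parts:
  assumes finP: "finite P" and part: "\<Union>P \<subseteq> V"
    and disj: "\<And>X Y. X \<in> P \<Longrightarrow> Y \<in> P \<Longrightarrow> X \<noteq> Y \<Longrightarrow> X \<inter> Y = {}"
    and few: "(\<Sum>X\<in>P. arcs E X (V - X)) + 6 \<le> 4 * card P"
  shows "\<exists>X\<in>P. \<exists>Y\<in>P. X \<noteq> Y \<and> arcs E X (V - X) + arcs E X Y \<le> 3 \<and>
    arcs E Y (V - Y) + arcs E X Y \<le> 3"
proof -
  define r where "r X = arcs E X (V - X)" for X
  define S where "S = {X \<in> P. r X \<le> 3}"
  define m where "m = card S"
  have finS: "finite S" using finP by (simp add: S_def)
  \<comment> \<open>Integers are used because parts with a large boundary have negative deficiency;
    dropping them can only increase the sum.\<close>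
  have "(\<Sum>X\<in>P. 4 - int (r X)) = 4 * int (card P) - int (\<Sum>X\<in>P. r X)"
    by (simp add: sum_subtractf)
  then have "6 \<le> (\<Sum>X\<in>P. 4 - int (r X))"
    using few unfolding r_def by linarith
  also have "\<dots> \<le> (\<Sum>X\<in>S. 4 - int (r X))"
  proof -
    have "(\<Sum>X\<in>P. 4 - int (r X)) = (\<Sum>X\<in>S. 4 - int (r X)) + (\<Sum>X\<in>P - S. 4 - int (r X))"
      using finP by (subst sum.subset_diff[of S P]) (auto simp: S_def)
    moreover have "(\<Sum>X\<in>P - S. 4 - int (r X)) \<le> 0" by (rule sum_nonpos) (auto simp: S_def)
    ultimately show ?thesis by simp
  qed
  finally have deficiency: "6 \<le> (\<Sum>X\<in>S. 4 - int (r X))" .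
  show ?thesis
  proof (cases "\<exists>X\<in>S. \<exists>Y\<in>S. X \<noteq> Y \<and> arcs E X Y = 0")
    case True
    then obtain X Y where "X \<in> S" "Y \<in> S" "X \<noteq> Y" "arcs E X Y = 0" by blast
    then show ?thesis unfolding S_def r_def by (intro bexI[of _ X] bexI[of _ Y]) auto
  next
    case False
    then have joined: "arcs E X Y \<ge> 1" if "X \<in> S" "Y \<in> S" "X \<noteq> Y" for X Y
      using that by (metis One_nat_def Suc_leI neq0_conv)
    have bound: "(\<Sum>Y\<in>S - {X}. arcs E X Y) \<le> r X" if X: "X \<in> S" for X
    proof -
      have "finite Y" if "Y \<in> P" for Y
        using that part finV by (meson Union_upper finite_subset)
      then have "(\<Sum>Y\<in>S - {X}. arcs E X Y) = arcs E X (\<Union>(S - {X}))"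
        using finS disj by (intro arcs_Union_right[symmetric]) (auto simp: S_def)
      moreover have "\<Union>(S - {X}) \<subseteq> V - X"
      proof
        fix v assume "v \<in> \<Union>(S - {X})"
        then obtain Y where "v \<in> Y" "Y \<in> P" "Y \<noteq> X" by (auto simp: S_def)
        then show "v \<in> V - X" using part disj[of X Y] X by (auto simp: S_def)
      qed
      then have "arcs E X (\<Union>(S - {X})) \<le> r X"
        unfolding r_def using finV by (intro arcs_mono_right) auto
      ultimately show ?thesis by simp
    qed
    have ge: "int m - 1 \<le> int (r X)" if X: "X \<in> S" for X
    proof -
      have "(\<Sum>Y\<in>S - {X}. 1) \<le> (\<Sum>Y\<in>S - {X}. arcs E X Y)"
        using joined[OF X] by (intro sum_mono) auto
      then have "m - 1 \<le> r X" using bound[OF X] X finS by (simp add: m_def)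
      then show ?thesis by linarith
    qed
    \<comment> \<open>Each boundary is split into the forced amount \<open>m - 1\<close> and a
      nonnegative excess.\<close>
    have "(\<Sum>X\<in>S. 4 - int (r X)) = int m * (5 - int m) - (\<Sum>X\<in>S. int (r X) - (int m - 1))"
      by (simp add: sum_subtractf m_def algebra_simps)
    then have tot: "(\<Sum>X\<in>S. int (r X) - (int m - 1)) \<le> int m * (5 - int m) - 6"
      using deficiency by linarith
    have "0 \<le> (\<Sum>X\<in>S. int (r X) - (int m - 1))" using ge by (intro sum_nonneg) auto
    then have mm: "6 \<le> int m * (5 - int m)" using tot by linarith
    have m23: "m = 2 \<or> m = 3"
    proof -
      have "m < 5"
      proof (rule ccontr)
        assume "\<not> m < 5"
        then have "int m * (5 - int m) \<le> 0" by (intro mult_nonneg_nonpos) auto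
        then show False using mm by simp
      qed
      then have "m \<in> {0, 1, 2, 3, 4}" by auto
      then show ?thesis using mm by auto
    qed
    \<comment> \<open>For both values of \<open>m\<close> the product \<open>m * (5 - m)\<close> is
      exactly 6, so no excess remains and every boundary equals \<open>m - 1\<close>.\<close>
    then have "(\<Sum>X\<in>S. int (r X) - (int m - 1)) \<le> 0" using tot by auto
    then have "(\<Sum>X\<in>S. int (r X) - (int m - 1)) = 0"
      using \<open>0 \<le> (\<Sum>X\<in>S. int (r X) - (int m - 1))\<close> by simp
    then have req: "int (r X) = int m - 1" if "X \<in> S" for X
      using sum_nonneg_eq_0_iff[OF finS, of "\<lambda>X. int (r X) - (int m - 1)"] ge that by auto
    obtain X Y where XY: "X \<in> S" "Y \<in> S" "X \<noteq> Y"
      using m23 card_le_Suc0_iff_eq[OF finS] unfolding m_def by force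
    \<comment> \<open>The other \<open>m - 2\<close> parts use at least one edge each out of the
      \<open>m - 1\<close> leaving \<open>X\<close>, so at most one goes to \<open>Y\<close> and
      both required sums are at most \<open>m\<close>.\<close>
    have "(\<Sum>Z\<in>S - {X}. arcs E X Z) = arcs E X Y + (\<Sum>Z\<in>S - {X} - {Y}. arcs E X Z)"
      using finS XY by (intro sum.remove) auto
    moreover have "(\<Sum>Z\<in>S - {X} - {Y}. 1) \<le> (\<Sum>Z\<in>S - {X} - {Y}. arcs E X Z)"
      using joined[OF XY(1)] by (intro sum_mono) auto
    moreover have "(\<Sum>Z\<in>S - {X} - {Y}. 1 :: nat) = m - 2"
      using finS XY by (simp add: m_def)
    ultimately have "arcs E X Y + (m - 2) \<le> r X" using bound[OF XY(1)] by linarith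
    then have "r X + arcs E X Y \<le> 3" "r Y + arcs E X Y \<le> 3"
      using req[OF XY(1)] req[OF XY(2)] m23 by auto
    then show ?thesis using XY unfolding S_def r_def by auto
  qed
qed

text \<open>Only edges outside \<open>D\<close> cross between classes, each seen from both ends, so
  the boundaries add up to at most \<open>4 * t - 6\<close> for \<open>t\<close> classes. The two
  parts this provides have boundary at most 3, less than \<open>d\<close>, and are therefore
  large.\<close>

lemma sparse_partition_second_eigenvalue:
  assumes d: "4 \<le> d" and D: "D \<subseteq> E" and few: "card (E - D) + 3 \<le> 2 * card (conn_class D ` V)"
  shows "real d - 3 / (real d + 1) \<le> graph_eigenvalue V E 2"
proof -
  let ?P = "conn_class D ` V"
  have sub: "X \<subseteq> V" if "X \<in> ?P" for X
    using that conn_class_subset[of D V] D edge by blast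
  have ne: "X \<noteq> {}" if "X \<in> ?P" for X using that conn_class_self by fast
  have disj: "X \<inter> Y = {}" if "X \<in> ?P" "Y \<in> ?P" "X \<noteq> Y" for X Y
  proof (rule ccontr)
    assume "X \<inter> Y \<noteq> {}"
    then obtain w where "w \<in> X" "w \<in> Y" by auto
    then have "X = conn_class D w" "Y = conn_class D w"
      using that(1,2) conn_class_eq_iff[of D] by (auto simp: conn_class_def[of D])
    then show False using that by simp
  qed
  \<comment> \<open>Ordered pairs again: each edge outside \<open>D\<close> accounts for at most two
    of them, whence the factor 2 below.\<close>
  let ?C = "{(u, v) \<in> V \<times> V. {u, v} \<in> E - D}"
  have "(\<Sum>X\<in>?P. arcs E X (V - X)) = (\<Sum>X\<in>?P. card {(u, v) \<in> X \<times> (V - X). {u, v} \<in> E})"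
    using sub finV by (intro sum.cong arcs_eq_card refl) (auto intro: finite_subset)
  also have "\<dots> = card (\<Union>X\<in>?P. {(u, v) \<in> X \<times> (V - X). {u, v} \<in> E})"
  proof (rule card_UN_disjoint[symmetric])
    show "\<forall>X\<in>?P. finite {(u, v) \<in> X \<times> (V - X). {u, v} \<in> E}"
    proof
      fix X assume "X \<in> ?P"
      then have "{(u, v) \<in> X \<times> (V - X). {u, v} \<in> E} \<subseteq> V \<times> V" using sub by auto
      then show "finite {(u, v) \<in> X \<times> (V - X). {u, v} \<in> E}" using finV by (simp add: finite_subset)
    qed
    show "\<forall>X\<in>?P. \<forall>Y\<in>?P. X \<noteq> Y \<longrightarrow> {(u, v) \<in> X \<times> (V - X). {u, v} \<in> E} \<inter>
        {(u, v) \<in> Y \<times> (V - Y). {u, v} \<in> E} = {}"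
    proof (intro ballI impI)
      fix X Y assume "X \<in> ?P" "Y \<in> ?P" "X \<noteq> Y"
      from disj[OF this] show "{(u, v) \<in> X \<times> (V - X). {u, v} \<in> E} \<inter>
        {(u, v) \<in> Y \<times> (V - Y). {u, v} \<in> E} = {}" by auto
    qed
  qed (use finV in simp)
  also have "\<dots> \<le> card ?C"
  proof (rule card_mono)
    show "finite ?C" using finV by (auto intro: finite_subset[of _ "V \<times> V"])
    show "(\<Union>X\<in>?P. {(u, v) \<in> X \<times> (V - X). {u, v} \<in> E}) \<subseteq> ?C"
    proof
      fix p assume "p \<in> (\<Union>X\<in>?P. {(u, v) \<in> X \<times> (V - X). {u, v} \<in> E})"
      then obtain u v w where p: "p = (u, v)"
        and a: "w \<in> V" "u \<in> conn_class D w" "v \<in> V" "v \<notin> conn_class D w" "{u, v} \<in> E"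
        by auto
      have "{u, v} \<notin> D"
      proof
        assume "{u, v} \<in> D"
        then have "(w, v) \<in> conn D" using a(2) conn_edge conn_trans by (fastforce simp: conn_class_def)
        then show False using a(4) by (simp add: conn_class_def)
      qed
      then show "p \<in> ?C" using p a edge[of "{u, v}"] by auto
    qed
  qed
  also have "card ?C \<le> (\<Sum>e\<in>E - D. card {(u, v). {u, v} = e})"
  proof -
    have "?C \<subseteq> (\<Union>e\<in>E - D. {(u, v). {u, v} = e})" by auto
    moreover have fin: "finite {(u, v). {u, v} = e}" if "e \<in> E - D" for e
    proof -
      have "{(u, v). {u, v} = e} \<subseteq> V \<times> V" using edge[of e] that by auto
      then show ?thesis using finV by (simp add: finite_subset)
    qed
    ultimately have "card ?C \<le> card (\<Union>e\<in>E - D. {(u, v). {u, v} = e})"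
      using finE by (intro card_mono) auto
    also have "\<dots> \<le> (\<Sum>e\<in>E - D. card {(u, v). {u, v} = e})"
      using finE by (intro card_UN_le) auto
    finally show ?thesis .
  qed
  also have "\<dots> \<le> (\<Sum>e\<in>E - D. 2)"
  proof (rule sum_mono)
    fix e assume "e \<in> E - D"
    then obtain a b where "e = {a, b}" using edge[of e] by (auto simp: card_2_iff)
    then have pairs: "{(u, v). {u, v} = e} = {(a, b), (b, a)}" by (auto simp: doubleton_eq_iff)
    have "card {(a, b), (b, a)} \<le> 2" by (cases "a = b") auto
    then show "card {(u, v). {u, v} = e} \<le> 2" by (simp only: pairs)
  qed
  finally have "(\<Sum>X\<in>?P. arcs E X (V - X)) \<le> 2 * card (E - D)" by simp
  then have "(\<Sum>X\<in>?P. arcs E X (V - X)) + 6 \<le> 4 * card ?P" using few by linarith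
  moreover have "\<Union>?P \<subseteq> V" using sub by auto
  ultimately have "\<exists>X\<in>?P. \<exists>Y\<in>?P. X \<noteq> Y \<and> arcs E X (V - X) + arcs E X Y \<le> 3 \<and>
      arcs E Y (V - Y) + arcs E X Y \<le> 3"
    by (intro weakly_joined_parts[OF finite_imageI[OF finV] _ disj])
  then obtain X Y where XY: "X \<in> ?P" "Y \<in> ?P" "X \<noteq> Y"
    and bd: "arcs E X (V - X) + arcs E X Y \<le> 3" "arcs E Y (V - Y) + arcs E X Y \<le> 3"
    by (elim bexE conjE)
  have cX: "d + 1 \<le> card X"
    using small_boundary_card[OF sub ne] XY(1) bd(1) d by simp
  have cY: "d + 1 \<le> card Y"
    using small_boundary_card[OF sub ne] XY(2) bd(2) d by simp
  \<comment> \<open>The constant \<open>3 / (d + 1)\<close> is the ratio of the boundary allowance 3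
    to the least possible size \<open>d + 1\<close> of a part.\<close>
  have bound: "3 \<le> 3 / (real d + 1) * card Z" if "d + 1 \<le> card Z" for Z :: "'a set"
  proof -
    have "real d + 1 \<le> card Z" using that by linarith
    then show ?thesis by (simp add: field_simps)
  qed
  show ?thesis
  proof (rule two_sets_second_eigenvalue)
    show "X \<subseteq> V" "X \<noteq> {}" "Y \<subseteq> V" "Y \<noteq> {}" "X \<inter> Y = {}" using sub ne disj XY by simp_all
    have "real (arcs E X (V - X) + arcs E X Y) \<le> 3" "real (arcs E Y (V - Y) + arcs E X Y) \<le> 3"
      using bd by linarith+
    then show "real (arcs E X (V - X) + arcs E X Y) \<le> 3 / (real d + 1) * card X"
      "real (arcs E Y (V - Y) + arcs E X Y) \<le> 3 / (real d + 1) * card Y"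
      using bound[OF cX] bound[OF cY] by linarith+
  qed
qed

end

theorem theorem1:
  fixes V :: "'a set" and E :: "'a set set" and d :: nat
  assumes "4 \<le> d"
    and "simple_graph V E"
    and "regular_graph d V E"
    and "graph_eigenvalue V E 2 < real d - 3 / (real d + 1)"
  shows "\<exists>T1 T2. spanning_tree V E T1 \<and> spanning_tree V E T2 \<and> T1 \<noteq> T2 \<and> T1 \<inter> T2 = {}"
proof -
  interpret regular_simple_graph V E d by unfold_locales (use assms in auto)
  obtain T1 T2 where T: "spanning_tree V E T1" "spanning_tree V E T2" "T1 \<inter> T2 = {}"
    using two_disjoint_spanning_trees_or_sparse_partition[OF assms(2)]
      sparse_partition_second_eigenvalue[OF assms(1)] assms(4) by (meson not_le)
  \<comment> \<open>Equal disjoint trees would be empty, leaving a single vertex of degree 0,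
    against \<open>4 \<le> d\<close>.\<close>
  moreover have "T1 \<noteq> T2"
  proof
    assume "T1 = T2"
    then have "connected_graph V {}" using T by (auto simp: spanning_tree_def is_tree_def)
    then have all: "u = v" if "u \<in> V" "v \<in> V" for u v
      using that by (auto simp: connected_graph_def)
    obtain u where u: "u \<in> V" using assms(2) by (auto simp: simple_graph_def)
    then have "V = {u}" using all by auto
    then show False using degree_sum[OF u] assms(1) no_loop by simp
  qed
  ultimately show ?thesis by blast
qed

end
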